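(* Let $p\in(1,2]$, $K\ge 1$ and $n\ge 2$, and define $c_n(K,p)>0$ by $$c_n(K,p)^p=\frac{\bigl(1+(n-1)K^2\bigr)\left(1+\frac{p-2}{nK^2}\right)}{p-1}.$$ (a) Let $f$ be a $K$-quasiregular harmonic mapping of the unit disk $\mathbb{D}\subset\mathbb{C}$ into $\mathbb{C}$ with $\operatorname{Im} f(0)=0$, and assume $\operatorname{Re} f\in\mathbf{h}^p$. Then $f\in\mathbf{h}^p$ and $$\|f\|_p\le c_2(K,p)\,\|\operatorname{Re} f\|_p .$$ (b) Let $f=(f_1,\dots,f_n)$ be a $K$-quasiregular harmonic mapping of the unit ball $\mathbb{B}\subset\mathbb{R}^n$ into $\mathbb{R}^n$, and assume $f_1\in\mathbf{h}^p$. Then $f\in\mathbf{h}^p$ and $$\|f\|_p^p\le |f(0)|^p+c_n(K,p)^p\bigl(\|f_1\|_p^p-|f_1(0)|^p\bigr).$$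
   Context: A mapping $f:G\to\mathbb{R}^n$ ($G\subset\mathbb{R}^n$ open, $n\ge2$) is $K$-quasiregular ($K\ge1$) if it is continuous, nonconstant, belongs to $W^{1,n}_{loc}(G,\mathbb{R}^n)$, and $|Df(x)|\le K\,\ell(Df(x))$ for a.e. $x\in G$, where $|Df(x)|=\sup_{|h|=1}|Df(x)h|$ and $\ell(Df(x))=\inf_{|h|=1}|Df(x)h|$. In the plane, $\mathbb{C}$ is identified with $\mathbb{R}^2$. A mapping is harmonic if each coordinate satisfies $\Delta u=0$. For a (real- or vector-valued) harmonic function $f$ on the unit ball $\mathbb{B}\subset\mathbb{R}^n$ (the unit disk $\mathbb{D}$ when $n=2$) with boundary sphere $\mathbb{S}$, set $M_p(f,r)=\bigl(\int_{\mathbb{S}}|f(r\zeta)|^p\,d\sigma(\zeta)\bigr)^{1/p}$, where $\sigma$ is the surface measure on $\mathbb{S}$ normalized so that $\sigma(\mathbb{S})=1$; $f\in\mathbf{h}^p$ (the harmonic Hardy space) means $\|f\|_p=\sup_{0<r<1}M_p(f,r)<\infty$. *)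

theory Defs
  imports "HOL-Analysis.Analysis"
begin

definition pd :: "'a::euclidean_space \<Rightarrow> ('a \<Rightarrow> real) \<Rightarrow> 'a \<Rightarrow> real" where
  "pd b u x = deriv (\<lambda>t. u (x + t *\<^sub>R b)) 0"

definition C1_on :: "'a::euclidean_space set \<Rightarrow> ('a \<Rightarrow> real) \<Rightarrow> bool" where
  "C1_on G u \<longleftrightarrow> continuous_on G u \<and>
     (\<forall>b\<in>Basis. (\<forall>x\<in>G. (\<lambda>t. u (x + t *\<^sub>R b)) differentiable (at 0)) \<and> continuous_on G (pd b u))"

definition C2_on :: "'a::euclidean_space set \<Rightarrow> ('a \<Rightarrow> real) \<Rightarrow> bool" where
  "C2_on G u \<longleftrightarrow> C1_on G u \<and> (\<forall>b\<in>Basis. C1_on G (pd b u))"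

definition harmonic_on :: "'a::euclidean_space set \<Rightarrow> ('a \<Rightarrow> real) \<Rightarrow> bool" where
  "harmonic_on G u \<longleftrightarrow> open G \<and> C2_on G u \<and> (\<forall>x\<in>G. (\<Sum>b\<in>Basis. pd b (pd b u) x) = 0)"

definition harmonic_map_on :: "'a::euclidean_space set \<Rightarrow> ('a \<Rightarrow> 'b::euclidean_space) \<Rightarrow> bool" where
  "harmonic_map_on G f \<longleftrightarrow> (\<forall>b\<in>Basis. harmonic_on G (\<lambda>x. f x \<bullet> b))"

definition test_fn :: "'a::euclidean_space set \<Rightarrow> ('a \<Rightarrow> real) \<Rightarrow> bool" where
  "test_fn G \<phi> \<longleftrightarrow> C1_on UNIV \<phi> \<and> compact (closure {x. \<phi> x \<noteq> 0}) \<and> closure {x. \<phi> x \<noteq> 0} \<subseteq> G"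

text \<open>f is in W^{1,p}_loc(G) with weak Jacobian entries g x i j = d_j f_i (x).\<close>
definition W1p_loc :: "real \<Rightarrow> 'a::euclidean_space set \<Rightarrow> ('a \<Rightarrow> 'b::euclidean_space)
    \<Rightarrow> ('a \<Rightarrow> 'b \<Rightarrow> 'a \<Rightarrow> real) \<Rightarrow> bool" where
  "W1p_loc p G f g \<longleftrightarrow>
     (\<forall>C. compact C \<and> C \<subseteq> G \<longrightarrow>
        (\<forall>i\<in>Basis. set_integrable lebesgue C (\<lambda>x. f x \<bullet> i) \<and>
                   set_integrable lebesgue C (\<lambda>x. \<bar>f x \<bullet> i\<bar> powr p) \<and>
          (\<forall>j\<in>Basis. set_integrable lebesgue C (\<lambda>x. g x i j) \<and>
                     set_integrable lebesgue C (\<lambda>x. \<bar>g x i j\<bar> powr p)))) \<and>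
     (\<forall>\<phi>. test_fn G \<phi> \<longrightarrow> (\<forall>i\<in>Basis. \<forall>j\<in>Basis.
        set_integrable lebesgue G (\<lambda>x. (f x \<bullet> i) * pd j \<phi> x) \<and>
        set_integrable lebesgue G (\<lambda>x. g x i j * \<phi> x) \<and>
        (LINT x:G|lebesgue. (f x \<bullet> i) * pd j \<phi> x) = - (LINT x:G|lebesgue. g x i j * \<phi> x)))"

definition Dlin :: "('a \<Rightarrow> 'b::euclidean_space \<Rightarrow> 'a::euclidean_space \<Rightarrow> real) \<Rightarrow> 'a \<Rightarrow> 'a \<Rightarrow> 'b" where
  "Dlin g x h = (\<Sum>i\<in>Basis. (\<Sum>j\<in>Basis. g x i j * (h \<bullet> j)) *\<^sub>R i)"

definition opnorm :: "('a::euclidean_space \<Rightarrow> 'b::euclidean_space) \<Rightarrow> real" where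
  "opnorm L = (SUP h\<in>sphere 0 1. norm (L h))"

definition ellnorm :: "('a::euclidean_space \<Rightarrow> 'b::euclidean_space) \<Rightarrow> real" where
  "ellnorm L = (INF h\<in>sphere 0 1. norm (L h))"

definition quasiregular :: "real \<Rightarrow> 'a::euclidean_space set \<Rightarrow> ('a \<Rightarrow> 'a) \<Rightarrow> bool" where
  "quasiregular K G f \<longleftrightarrow> K \<ge> 1 \<and> open G \<and> continuous_on G f \<and> \<not> (\<exists>c. \<forall>x\<in>G. f x = c) \<and>
     (\<exists>g. W1p_loc (real DIM('a)) G f g \<and>
          (AE x in lebesgue. x \<in> G \<longrightarrow> opnorm (Dlin g x) \<le> K * ellnorm (Dlin g x)))"

text \<open>Integral mean M_p(f,r) over the sphere w.r.t. normalized surface measure, realised as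
  the image of normalized Lebesgue measure on the unit ball under radial projection.\<close>
definition Mp :: "real \<Rightarrow> ('a::euclidean_space \<Rightarrow> 'b::real_normed_vector) \<Rightarrow> real \<Rightarrow> real" where
  "Mp p f r = ((LINT x:ball 0 1|lebesgue. norm (f (r *\<^sub>R (x /\<^sub>R norm x))) powr p)
                 / measure lebesgue (ball (0::'a) 1)) powr (1 / p)"

definition hardy :: "real \<Rightarrow> ('a::euclidean_space \<Rightarrow> 'b::real_normed_vector) \<Rightarrow> bool" where
  "hardy p f \<longleftrightarrow> bdd_above (Mp p f ` {0<..<1})"

definition hnorm :: "real \<Rightarrow> ('a::euclidean_space \<Rightarrow> 'b::real_normed_vector) \<Rightarrow> real" where
  "hnorm p f = (SUP r\<in>{0<..<1}. Mp p f r)"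

definition cnKp :: "nat \<Rightarrow> real \<Rightarrow> real \<Rightarrow> real" where
  "cnKp n K p = ((1 + (real n - 1) * K\<^sup>2) * (1 + (p - 2) / (real n * K\<^sup>2)) / (p - 1)) powr (1 / p)"

end

theory Submission
  imports Defs
begin

text \<open>The theorem is a comparison of Laplacians. Writing \<open>n\<close> for the dimension and
  \<open>C = c\<^sub>n(K,p)\<^sup>p\<close>, quasiregularity gives, at every point,
  \<open>\<Delta> (\<epsilon> + |f|\<^sup>2)\<^bsup>p/2\<^esup> \<le> C \<Delta> (\<epsilon> + f\<^sub>1\<^sup>2)\<^bsup>p/2\<^esup>\<close> for every \<open>\<epsilon> > 0\<close>. Indeed the dilatation bound
  passes to the adjoint of \<open>Df\<close>, so all gradients \<open>\<nabla>f\<^sub>i\<close> are controlled by \<open>\<nabla>f\<^sub>1\<close> and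
  \<open>|Df\<^sup>T f|\<close> is bounded below by a multiple of \<open>|Df| |f|\<close>. Hence
  \<open>C (\<epsilon> + f\<^sub>1\<^sup>2)\<^bsup>p/2\<^esup> - (\<epsilon> + |f|\<^sup>2)\<^bsup>p/2\<^esup>\<close> is a smooth subharmonic function; its value at \<open>0\<close> is
  at most its mean over the sphere of radius \<open>r\<close>, and one lets \<open>\<epsilon> \<rightarrow> 0\<close> and takes the supremum
  over \<open>r\<close>. The dilatation bound is assumed almost everywhere for weak derivatives; it holds
  everywhere for the classical ones by the fundamental lemma of the calculus of variations.
  The submean value property is derived without surface integrals: integrating
  \<open>div (\<psi>(|x|\<^sup>2) \<nabla>g)\<close> shows that \<open>t \<mapsto> \<integral> \<eta>(|x|\<^sup>2) g(tx) dx\<close> is nondecreasing,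
  and the weights \<open>\<eta>\<close> are then concentrated on thin shells.\<close>

section \<open>Differentiation along lines and integration by parts\<close>

text \<open>\<open>pd\<close> and \<open>C1_on\<close> only speak of the parameter 0 on a line.
  Moving the base point along the line gives derivatives at every parameter, which the mean value
  theorem and differentiation under the integral require.\<close>

lemma DERIV_line_shift:
  fixes u :: "'a::real_vector \<Rightarrow> real"
  assumes "((\<lambda>s. u ((x + t *\<^sub>R b) + s *\<^sub>R b)) has_real_derivative D) (at 0)"
  shows "((\<lambda>s. u (x + s *\<^sub>R b)) has_real_derivative D) (at t)"
proof -
  have "(\<lambda>s. u ((x + t *\<^sub>R b) + s *\<^sub>R b)) = (\<lambda>s. (\<lambda>s. u (x + s *\<^sub>R b)) (s + t))"
    by (simp add: algebra_simps)
  with assms show ?thesis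
    using DERIV_shift[of "\<lambda>s. u (x + s *\<^sub>R b)" D 0 t] by simp
qed

section \<open>Functions with continuous partial derivatives\<close>

lemma C1_on_DERIV:
  assumes "C1_on G u" "b \<in> Basis" "x \<in> G"
  shows "((\<lambda>t. u (x + t *\<^sub>R b)) has_real_derivative pd b u x) (at 0)"
  using assms unfolding C1_on_def pd_def by (simp add: DERIV_deriv_iff_real_differentiable)

lemma pd_eqI:
  assumes "((\<lambda>t. u (x + t *\<^sub>R b)) has_real_derivative D) (at 0)"
  shows "pd b u x = D"
  using assms unfolding pd_def by (rule DERIV_imp_deriv)

text \<open>Since \<open>pd\<close> is a total operator defined through \<open>deriv\<close>, an
  explicit derivative \<open>D b x\<close> settles both differentiability and the value of
  \<open>pd\<close>. Continuity can then be checked on the formula.\<close>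

lemma C1_onI:
  assumes "continuous_on G u"
    and D: "\<And>b x. b \<in> Basis \<Longrightarrow> x \<in> G \<Longrightarrow> ((\<lambda>t. u (x + t *\<^sub>R b)) has_real_derivative D b x) (at 0)"
    and "\<And>b. b \<in> Basis \<Longrightarrow> continuous_on G (D b)"
  shows "C1_on G u"
  unfolding C1_on_def
proof (intro conjI ballI)
  fix b :: 'a assume b: "b \<in> Basis"
  show "(\<lambda>t. u (x + t *\<^sub>R b)) differentiable (at 0)" if "x \<in> G" for x
    using D[OF b that] real_differentiable_def by blast
  have "continuous_on G (pd b u) \<longleftrightarrow> continuous_on G (D b)"
    using D[OF b] by (intro continuous_on_cong refl pd_eqI)
  then show "continuous_on G (pd b u)"
    using assms(3)[OF b] by simp
qed fact

lemma C1_on_imp_continuous_on: "C1_on G u \<Longrightarrow> continuous_on G u"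
  and C1_on_imp_continuous_on_pd: "C1_on G u \<Longrightarrow> b \<in> Basis \<Longrightarrow> continuous_on G (pd b u)"
  by (simp_all add: C1_on_def)

lemma C1_on_const: "C1_on G (\<lambda>x. c)"
  by (rule C1_onI[where D="\<lambda>_ _. 0"]) (auto intro!: derivative_eq_intros)

lemma C1_on_mult:
  assumes u: "C1_on G u" and v: "C1_on G v"
  shows "C1_on G (\<lambda>x. u x * v x)"
proof (rule C1_onI)
  fix b x :: 'a assume "b \<in> Basis" "x \<in> G"
  then show "((\<lambda>t. u (x + t *\<^sub>R b) * v (x + t *\<^sub>R b)) has_real_derivative
      (pd b u x * v x + pd b v x * u x)) (at 0)"
    using DERIV_mult[OF C1_on_DERIV[OF u] C1_on_DERIV[OF v]] by fastforce
qed (use u v in \<open>auto intro!: continuous_intros intro: C1_on_imp_continuous_on_pd C1_on_imp_continuous_on\<close>)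

lemma C1_on_prod:
  assumes "\<And>i. i \<in> I \<Longrightarrow> C1_on G (u i)"
  shows "C1_on G (\<lambda>x. \<Prod>i\<in>I. u i x)"
  using assms by (induction I rule: infinite_finite_induct) (auto simp: C1_on_const C1_on_mult)

lemma C1_on_compose:
  assumes \<theta>: "\<And>s. (\<theta> has_real_derivative \<theta>' s) (at s)" and \<theta>': "continuous_on UNIV \<theta>'"
    and u: "C1_on G u"
  shows "C1_on G (\<lambda>x. \<theta> (u x))"
proof (rule C1_onI)
  have "continuous_on UNIV \<theta>"
    using \<theta> DERIV_isCont continuous_at_imp_continuous_on by blast
  then show "continuous_on G (\<lambda>x. \<theta> (u x))"
    by (rule continuous_on_compose2) (auto simp: C1_on_imp_continuous_on[OF u])
  fix b x :: 'a assume b: "b \<in> Basis" 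
  show "continuous_on G (\<lambda>x. \<theta>' (u x) * pd b u x)"
    by (intro continuous_intros continuous_on_compose2[OF \<theta>'] C1_on_imp_continuous_on_pd 
         C1_on_imp_continuous_on u b) auto
  assume "x \<in> G"
  show "((\<lambda>t. \<theta> (u (x + t *\<^sub>R b))) has_real_derivative \<theta>' (u x) * pd b u x) (at 0)"
    by (rule DERIV_chain2[OF _ C1_on_DERIV[OF u b \<open>x \<in> G\<close>]]) (simp add: \<theta>)
qed

lemma DERIV_inner_line: "((\<lambda>t. (x + t *\<^sub>R b) \<bullet> a) has_real_derivative (b \<bullet> a)) (at 0)"
  by (auto simp: inner_simps intro!: derivative_eq_intros)

lemma DERIV_norm_sq_line: "((\<lambda>t. (norm (x + t *\<^sub>R b))\<^sup>2) has_real_derivative (2 * (x \<bullet> b))) (at 0)"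
  unfolding power2_norm_eq_inner
  by (auto simp: inner_simps inner_commute intro!: derivative_eq_intros)

lemma C1_on_inner: "C1_on G (\<lambda>x. x \<bullet> a)"
  by (rule C1_onI[where D="\<lambda>b _. b \<bullet> a"]) (auto intro!: DERIV_inner_line continuous_intros)

lemma C1_on_norm_sq: "C1_on G (\<lambda>x. (norm x)\<^sup>2)"
  by (rule C1_onI[where D="\<lambda>b x. 2 * (x \<bullet> b)"]) (auto intro!: DERIV_norm_sq_line continuous_intros)

text \<open>The open sets \<open>G\<close> and \<open>- C\<close> cover the space, and on their
  overlap both branches are zero, so the two continuous pieces glue.\<close>

lemma continuous_on_zero_extension:
  fixes f :: "'a::t2_space \<Rightarrow> 'b::real_normed_vector"
  assumes "open G" "compact C" "C \<subseteq> G" "continuous_on G f" "\<And>x. x \<in> G \<Longrightarrow> x \<notin> C \<Longrightarrow> f x = 0"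
  shows "continuous_on UNIV (\<lambda>x. if x \<in> G then f x else 0)"
proof -
  have "continuous_on (G \<union> - C) (\<lambda>x. if x \<in> G then f x else 0)"
    using assms by (intro continuous_on_cases_local_open)
      (auto intro!: open_subset open_Compl compact_imp_closed)
  moreover have "G \<union> - C = UNIV" using assms by auto
  ultimately show ?thesis by simp
qed

section \<open>Integrals over the whole space with compact support\<close>

lemma integrable_continuous_compact_support:
  fixes f :: "'a::euclidean_space \<Rightarrow> real"
  assumes "continuous_on UNIV f" "compact C" "\<And>x. x \<notin> C \<Longrightarrow> f x = 0"
  shows "integrable lborel f"
proof -
  have "integrable lborel (\<lambda>x. indicator C x *\<^sub>R f x)"
    using assms by (intro borel_integrable_compact) (auto intro: continuous_on_subset)
  also have "(\<lambda>x. indicator C x *\<^sub>R f x) = f"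
    using assms(3) by (auto simp: indicator_def fun_eq_iff)
  finally show ?thesis .
qed

text \<open>Differentiation under the integral sign. By the mean value theorem every difference
  quotient at \<open>x\<close> equals some value \<open>F' t x\<close>, so it is dominated by
  \<open>M\<close> on \<open>C\<close> and vanishes off \<open>C\<close>. Dominated convergence
  along sequences then applies.\<close>

lemma DERIV_integral_lborel:
  fixes F F' :: "real \<Rightarrow> 'a::euclidean_space \<Rightarrow> real"
  assumes d: "d > 0" and C: "compact C"
    and der: "\<And>t x. \<bar>t - t0\<bar> < d \<Longrightarrow> ((\<lambda>t. F t x) has_real_derivative F' t x) (at t)"
    and bound: "\<And>t x. \<bar>t - t0\<bar> < d \<Longrightarrow> \<bar>F' t x\<bar> \<le> M"
    and supp: "\<And>t x. \<bar>t - t0\<bar> < d \<Longrightarrow> x \<notin> C \<Longrightarrow> F' t x = 0"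
    and int: "\<And>t. \<bar>t - t0\<bar> < d \<Longrightarrow> integrable lborel (F t)"
    and meas: "F' t0 \<in> borel_measurable borel"
  shows "((\<lambda>t. LINT x|lborel. F t x) has_real_derivative (LINT x|lborel. F' t0 x)) (at t0)"
  unfolding has_field_derivative_iff tendsto_at_iff_sequentially
proof (intro allI impI)
  fix X :: "nat \<Rightarrow> real"
  assume X: "\<forall>i. X i \<in> UNIV - {t0}" and lim: "X \<longlonglongrightarrow> t0"
  obtain N where N: "\<And>n. n \<ge> N \<Longrightarrow> \<bar>X n - t0\<bar> < d"
    using LIMSEQ_D[OF lim d] by (auto simp: real_norm_def)
  \<comment> \<open>Dropping the first \<open>N\<close> terms puts the whole sequence within
    distance \<open>d\<close> of \<open>t0\<close>, where all hypotheses hold;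
    \<open>LIMSEQ_offset\<close> restores \<open>X\<close> at the end.\<close>
  define Y where "Y n = X (n + N)" for n
  have Y: "\<bar>Y n - t0\<bar> < d" "Y n \<noteq> t0" for n
    using N X by (auto simp: Y_def)
  have Ylim: "Y \<longlonglongrightarrow> t0"
    unfolding Y_def using lim by (rule LIMSEQ_ignore_initial_segment)
  have intC: "integrable lborel (\<lambda>x. indicator C x * M)"
    using integrable_mult_right[OF borel_integrable_compact[OF C, of "\<lambda>_. 1::real"], of M]
    by (simp add: mult.commute)
  have quot: "\<exists>t. \<bar>t - t0\<bar> < d \<and> (F s x - F t0 x) / (s - t0) = F' t x" if s: "\<bar>s - t0\<bar> < d" "s \<noteq> t0" for s x
  proof -
    consider "s < t0" | "t0 < s" using s by linarith
    then show ?thesis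
    proof cases
      case 1
      obtain z where "s < z" "z < t0" "F t0 x - F s x = (t0 - s) * F' z x"
        using MVT2[OF 1, of "\<lambda>t. F t x" "\<lambda>t. F' t x"] der s by force
      then show ?thesis using s by (intro exI[of _ z]) (auto simp: field_simps)
    next
      case 2
      obtain z where "t0 < z" "z < s" "F s x - F t0 x = (s - t0) * F' z x"
        using MVT2[OF 2, of "\<lambda>t. F t x" "\<lambda>t. F' t x"] der s by force
      then show ?thesis using s by (intro exI[of _ z]) (auto simp: field_simps)
    qed
  qed
  have "(\<lambda>n. LINT x|lborel. (F (Y n) x - F t0 x) / (Y n - t0)) \<longlonglongrightarrow> (LINT x|lborel. F' t0 x)"
  proof (rule integral_dominated_convergence[OF _ _ intC])
    show "(\<lambda>x. (F (Y n) x - F t0 x) / (Y n - t0)) \<in> borel_measurable lborel" for n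
      using borel_measurable_integrable[OF int[OF Y(1)[of n]]] borel_measurable_integrable[OF int[of t0]] d
      by simp
    show "AE x in lborel. (\<lambda>n. (F (Y n) x - F t0 x) / (Y n - t0)) \<longlonglongrightarrow> F' t0 x"
    proof (intro AE_I2)
      fix x
      have "((\<lambda>t. (F t x - F t0 x) / (t - t0)) \<longlongrightarrow> F' t0 x) (at t0)"
        using der[of t0 x] d by (simp add: has_field_derivative_iff)
      then show "(\<lambda>n. (F (Y n) x - F t0 x) / (Y n - t0)) \<longlonglongrightarrow> F' t0 x"
        unfolding tendsto_at_iff_sequentially using Y(2) Ylim by (auto simp: o_def)
    qed
    show "AE x in lborel. norm ((F (Y n) x - F t0 x) / (Y n - t0)) \<le> indicator C x * M" for n
    proof (intro AE_I2)
      fix x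
      obtain t where "\<bar>t - t0\<bar> < d" "(F (Y n) x - F t0 x) / (Y n - t0) = F' t x"
        using quot[OF Y, of n x] by blast
      then show "norm ((F (Y n) x - F t0 x) / (Y n - t0)) \<le> indicator C x * M"
        using bound[of t x] supp[of t x] by (auto simp: indicator_def)
    qed
  qed (use meas in simp)
  moreover have "(LINT x|lborel. (F (Y n) x - F t0 x) / (Y n - t0)) =
      ((LINT x|lborel. F (Y n) x) - (LINT x|lborel. F t0 x)) / (Y n - t0)" for n
    using int Y(1) d by simp
  ultimately have "(\<lambda>n. ((LINT x|lborel. F (Y n) x) - (LINT x|lborel. F t0 x)) / (Y n - t0)) \<longlonglongrightarrow> (LINT x|lborel. F' t0 x)"
    by (simp only:)
  then show "((\<lambda>y. ((LINT x|lborel. F y x) - (LINT x|lborel. F t0 x)) / (y - t0)) \<circ> X) \<longlonglongrightarrow> (LINT x|lborel. F' t0 x)"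
    unfolding Y_def o_def by (rule LIMSEQ_offset)
qed

lemma integral_lborel_translation:
  fixes f :: "'a::euclidean_space \<Rightarrow> real"
  assumes "f \<in> borel_measurable borel"
  shows "(LINT x|lborel. f (x + a)) = (LINT x|lborel. f x)"
proof -
  have "(LINT x|lborel. f x) = (LINT x|distr lborel borel ((+) a). f x)"
    by (simp add: lborel_distr_plus)
  also have "\<dots> = (LINT x|lborel. f (a + x))"
    using assms by (subst integral_distr) auto
  finally show ?thesis by (simp add: add.commute)
qed

text \<open>By translation invariance the integral of \<open>V (x + t *\<^sub>R b)\<close> does not
  depend on \<open>t\<close>. Differentiating it at 0 under the integral sign gives the integral of
  \<open>V'\<close>.\<close>

lemma integral_line_derivative_eq_0:
  fixes V V' :: "'a::euclidean_space \<Rightarrow> real"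
  assumes V: "continuous_on UNIV V" and V': "continuous_on UNIV V'" and C: "compact C"
    and supp: "\<And>x. x \<notin> C \<Longrightarrow> V x = 0" "\<And>x. x \<notin> C \<Longrightarrow> V' x = 0"
    and der: "\<And>x. ((\<lambda>t. V (x + t *\<^sub>R b)) has_real_derivative V' x) (at 0)"
  shows "(LINT x|lborel. V' x) = 0"
proof -
  obtain R where R: "\<And>x. x \<in> C \<Longrightarrow> norm x \<le> R"
    using compact_imp_bounded[OF C] by (auto simp: bounded_iff)
  have "bounded (V' ` C)"
    using V' C by (intro compact_imp_bounded compact_continuous_image) (auto intro: continuous_on_subset)
  then obtain M0 where M0: "\<And>x. x \<in> C \<Longrightarrow> \<bar>V' x\<bar> \<le> M0"
    by (auto simp: bounded_iff)
  have M: "\<bar>V' x\<bar> \<le> max 0 M0" for x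
    using M0[of x] supp(2)[of x] by (cases "x \<in> C") auto
  have meas: "V \<in> borel_measurable borel" "V' \<in> borel_measurable borel"
    using V V' borel_measurable_continuous_onI by blast+
  \<comment> \<open>One ball, larger by \<open>norm b\<close>, contains the supports of all
    translates with \<bar>t\<bar> < 1.\<close>
  have shift: "x + t *\<^sub>R b \<notin> C" if "\<bar>t\<bar> < 1" "x \<notin> cball 0 (R + norm b)" for t x
  proof
    assume "x + t *\<^sub>R b \<in> C"
    then have "norm (x + t *\<^sub>R b) \<le> R" by (rule R)
    moreover have "norm x \<le> norm (x + t *\<^sub>R b) + \<bar>t\<bar> * norm b"
      using norm_triangle_ineq4[of "x + t *\<^sub>R b" "t *\<^sub>R b"] by simp
    moreover have "\<bar>t\<bar> * norm b \<le> norm b"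
      using that by (simp add: mult_left_le_one_le)
    ultimately show False using that by simp
  qed
  have "((\<lambda>t. LINT x|lborel. V (x + t *\<^sub>R b)) has_real_derivative (LINT x|lborel. V' (x + 0 *\<^sub>R b))) (at 0)"
  proof (rule DERIV_integral_lborel[of 1 "cball 0 (R + norm b)"])
    fix t :: real and x
    show "((\<lambda>t. V (x + t *\<^sub>R b)) has_real_derivative V' (x + t *\<^sub>R b)) (at t)"
      by (rule DERIV_line_shift) (rule der)
    show "\<bar>V' (x + t *\<^sub>R b)\<bar> \<le> max 0 M0" by (rule M)
    assume t: "\<bar>t - 0\<bar> < 1"
    show "V' (x + t *\<^sub>R b) = 0" if "x \<notin> cball 0 (R + norm b)"
      using shift[of t x] that t supp(2) by simp
    show "integrable lborel (\<lambda>x. V (x + t *\<^sub>R b))"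
    proof (rule integrable_continuous_compact_support[OF _ compact_cball[of 0 "R + norm b"]])
      show "continuous_on UNIV (\<lambda>x. V (x + t *\<^sub>R b))"
        by (intro continuous_on_compose2[OF V] continuous_intros) auto
    qed (use shift[of t] t supp(1) in simp)
  qed (use meas in auto)
  moreover have "((\<lambda>t. LINT x|lborel. V (x + t *\<^sub>R b)) has_real_derivative 0) (at 0)"
    using meas by (simp add: integral_lborel_translation)
  ultimately show ?thesis
    using DERIV_unique by fastforce
qed

text \<open>The product \<open>u x * \<phi> x\<close>, extended by zero off \<open>G\<close>, is
  continuous with compact support. Its derivative along \<open>b\<close> is the sum of the two
  integrands, and the integral of such a derivative is zero.\<close>

lemma integration_by_parts_test_fn:
  fixes u u' :: "'a::euclidean_space \<Rightarrow> real"
  assumes G: "open G" and b: "b \<in> Basis" and \<phi>: "test_fn G \<phi>"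
    and u: "continuous_on G u" and u': "continuous_on G u'"
    and der: "\<And>x. x \<in> G \<Longrightarrow> ((\<lambda>t. u (x + t *\<^sub>R b)) has_real_derivative u' x) (at 0)"
  shows "set_integrable lborel G (\<lambda>x. u x * pd b \<phi> x)"
    and "set_integrable lborel G (\<lambda>x. u' x * \<phi> x)"
    and "(LINT x:G|lborel. u x * pd b \<phi> x) = - (LINT x:G|lborel. u' x * \<phi> x)"
proof -
  define C where "C = closure {x. \<phi> x \<noteq> 0}"
  have C: "compact C" "C \<subseteq> G" and \<phi>1: "C1_on UNIV \<phi>"
    using \<phi> by (auto simp: test_fn_def C_def)
  have \<phi>0: "\<phi> x = 0" if "x \<notin> C" for x
    using that closure_subset[of "{x. \<phi> x \<noteq> 0}"] by (auto simp: C_def)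
  \<comment> \<open>A derivative at 0 sees only small \<open>t\<close>. Hence near a point of
    \<open>G\<close> only the product branch matters, and near a point of \<open>- C\<close>
    everything is identically zero.\<close>
  have nearby: "\<forall>\<^sub>F t in nhds 0. x + t *\<^sub>R b \<in> S" if "open S" "x \<in> S" for S x
  proof -
    have "((\<lambda>t. x + t *\<^sub>R b) \<longlongrightarrow> x + 0 *\<^sub>R b) (nhds 0)"
      by (intro tendsto_intros filterlim_ident)
    then show ?thesis
      using that by (auto dest: topological_tendstoD)
  qed
  have open_C: "open (- C)"
    using C by (simp add: compact_imp_closed open_Compl)
  have pd0: "pd b \<phi> x = 0" if "x \<notin> C" for x
  proof (rule pd_eqI)
    have "\<forall>\<^sub>F t in nhds 0. \<phi> (x + t *\<^sub>R b) = 0"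
      using nearby[OF open_C, of x] that \<phi>0 by (auto elim: eventually_mono)
    then show "((\<lambda>t. \<phi> (x + t *\<^sub>R b)) has_real_derivative 0) (at 0)"
      using DERIV_cong_ev[OF refl _ refl, of _ "\<lambda>_. 0"] by fastforce
  qed
  have cont: "continuous_on UNIV (\<lambda>x. if x \<in> G then w x * \<psi> x else 0)"
    if "continuous_on G w" "continuous_on UNIV \<psi>" "\<And>x. x \<notin> C \<Longrightarrow> \<psi> x = 0" for w \<psi> :: "'a \<Rightarrow> real"
  proof (rule continuous_on_zero_extension[OF G C])
    show "continuous_on G (\<lambda>x. w x * \<psi> x)"
      using that by (auto intro!: continuous_on_mult intro: continuous_on_subset)
  qed (simp add: that)
  have c: "continuous_on UNIV \<phi>" "continuous_on UNIV (pd b \<phi>)"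
    using \<phi>1 b by (auto intro: C1_on_imp_continuous_on_pd C1_on_imp_continuous_on)
  let ?A = "\<lambda>x. if x \<in> G then u x * pd b \<phi> x else 0"
  let ?B = "\<lambda>x. if x \<in> G then u' x * \<phi> x else 0"
  let ?V = "\<lambda>x. if x \<in> G then u x * \<phi> x else 0"
  have contA: "continuous_on UNIV ?A" and contB: "continuous_on UNIV ?B" and contV: "continuous_on UNIV ?V"
    using cont[OF u c(2) pd0] cont[OF u' c(1) \<phi>0] cont[OF u c(1) \<phi>0] by simp_all
  have iA: "integrable lborel ?A" and iB: "integrable lborel ?B"
    using integrable_continuous_compact_support[OF contA C(1)] pd0
      integrable_continuous_compact_support[OF contB C(1)] \<phi>0 by auto
  have eq: "(\<lambda>x. indicator G x *\<^sub>R (u x * pd b \<phi> x)) = ?A" "(\<lambda>x. indicator G x *\<^sub>R (u' x * \<phi> x)) = ?B"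
    by (auto simp: indicator_def)
  show "set_integrable lborel G (\<lambda>x. u x * pd b \<phi> x)" "set_integrable lborel G (\<lambda>x. u' x * \<phi> x)"
    unfolding set_integrable_def eq by fact+
  have "(LINT x|lborel. ?A x + ?B x) = 0"
  proof (rule integral_line_derivative_eq_0[OF contV _ C(1)])
    show "continuous_on UNIV (\<lambda>x. ?A x + ?B x)"
      by (intro continuous_on_add contA contB)
    fix x
    show "((\<lambda>t. ?V (x + t *\<^sub>R b)) has_real_derivative ?A x + ?B x) (at 0)"
    proof (cases "x \<in> G")
      case True
      have "((\<lambda>t. u (x + t *\<^sub>R b) * \<phi> (x + t *\<^sub>R b)) has_real_derivative ?A x + ?B x) (at 0)"
        using DERIV_mult[OF der[OF True] C1_on_DERIV[OF \<phi>1 b UNIV_I, of x]] True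
        by (simp add: algebra_simps)
      moreover have "\<forall>\<^sub>F t in nhds 0. ?V (x + t *\<^sub>R b) = u (x + t *\<^sub>R b) * \<phi> (x + t *\<^sub>R b)"
        using nearby[OF G True] by (auto elim: eventually_mono)
      ultimately show ?thesis
        using DERIV_cong_ev[OF refl _ refl] by fastforce
    next
      case False
      then have "x \<in> - C" using C(2) by auto
      from nearby[OF open_C this] have "\<forall>\<^sub>F t in nhds 0. ?V (x + t *\<^sub>R b) = 0"
        by (rule eventually_mono) (simp add: \<phi>0)
      then have "((\<lambda>t. ?V (x + t *\<^sub>R b)) has_real_derivative 0) (at 0)"
        using DERIV_cong_ev[OF refl _ refl, of _ "\<lambda>_. 0"] by fastforce
      then show ?thesis using False by simp
    qed
  qed (auto simp: \<phi>0 pd0)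
  then show "(LINT x:G|lborel. u x * pd b \<phi> x) = - (LINT x:G|lborel. u' x * \<phi> x)"
    unfolding set_lebesgue_integral_def eq using iA iB by simp
qed

section \<open>The fundamental lemma of the calculus of variations\<close>

text \<open>A continuously differentiable cut-off that vanishes up to and including 0 and increases
  to 1 at infinity. The rescalings \<open>bump (k * t)\<close> converge to the indicator of the open
  half-line t > 0, so products of them approximate indicators of balls, boxes and shells by
  functions of the class that \<open>test_fn\<close> asks for.\<close>

definition bump :: "real \<Rightarrow> real" where
  "bump t = (max 0 t)\<^sup>2 / (1 + (max 0 t)\<^sup>2)"

text \<open>Squaring removes the corner of \<open>max 0 t\<close>: at the origin the difference
  quotient is at most \<bar>s\<bar> in absolute value.\<close>

lemma DERIV_max_0_sq: "((\<lambda>t::real. (max 0 t)\<^sup>2) has_real_derivative 2 * max 0 t) (at t)"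
proof -
  consider "t > 0" | "t < 0" | "t = 0" by linarith
  then show ?thesis
  proof cases
    case 1
    then have "\<forall>\<^sub>F s in nhds t. (max 0 s)\<^sup>2 = s\<^sup>2"
      by (auto simp: max_def intro: eventually_mono[OF eventually_nhds_in_open[of "{0<..}"]])
    moreover have "((\<lambda>t. t\<^sup>2) has_real_derivative 2 * max 0 t) (at t)"
      using 1 by (auto intro!: derivative_eq_intros)
    ultimately show ?thesis
      using DERIV_cong_ev[OF refl _ refl] by fastforce
  next
    case 2
    then have "\<forall>\<^sub>F s in nhds t. (max 0 s)\<^sup>2 = 0"
      by (auto simp: max_def intro: eventually_mono[OF eventually_nhds_in_open[of "{..<0}"]])
    moreover have "((\<lambda>t. 0) has_real_derivative 2 * max 0 t) (at t)"
      using 2 by simp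
    ultimately show ?thesis
      using DERIV_cong_ev[OF refl _ refl] by fastforce
  next
    case 3
    have "((\<lambda>s. ((max 0 s)\<^sup>2 - (max 0 (0::real))\<^sup>2) / (s - 0)) \<longlongrightarrow> 0) (at 0)"
    proof (rule Lim_null_comparison)
      show "\<forall>\<^sub>F s in at 0. norm (((max 0 s)\<^sup>2 - (max 0 (0::real))\<^sup>2) / (s - 0)) \<le> \<bar>s\<bar>"
        by (intro always_eventually) (auto simp: max_def power2_eq_square)
      show "((\<lambda>s::real. \<bar>s\<bar>) \<longlongrightarrow> 0) (at 0)"
        by (rule tendsto_rabs_zero) (rule tendsto_ident_at)
    qed
    then show ?thesis using 3 by (simp add: has_field_derivative_iff)
  qed
qed

lemma DERIV_bump:
  "(bump has_real_derivative 2 * max 0 t / (1 + (max 0 t)\<^sup>2)\<^sup>2) (at t)"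
  unfolding bump_def
proof (rule DERIV_cong)
  show "((\<lambda>t. (max 0 t)\<^sup>2 / (1 + (max 0 t)\<^sup>2)) has_real_derivative
      (2 * max 0 t * (1 + (max 0 t)\<^sup>2) - (max 0 t)\<^sup>2 * (0 + 2 * max 0 t)) / ((1 + (max 0 t)\<^sup>2) * (1 + (max 0 t)\<^sup>2))) (at t)"
    by (intro DERIV_divide DERIV_add DERIV_const DERIV_max_0_sq) (simp add: add_nonneg_eq_0_iff)
qed (simp add: algebra_simps power2_eq_square)

lemma bump_eq_0: "t \<le> 0 \<Longrightarrow> bump t = 0"
  and bump_range: "0 \<le> bump t" "bump t \<le> 1"
  by (simp_all add: bump_def divide_le_eq_1 add_pos_nonneg)

lemma tendsto_bump: "(\<lambda>k. bump (real k * t)) \<longlonglongrightarrow> (if t > 0 then 1 else 0)"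
proof (cases "t > 0")
  case True
  have "(\<lambda>k. 1 - inverse (1 + (real k * t)\<^sup>2)) \<longlonglongrightarrow> 1 - 0"
  proof (intro tendsto_intros tendsto_inverse_0_at_top)
    have "filterlim (\<lambda>k. real k * t) at_top sequentially"
      using True filterlim_real_sequentially by (simp add: filterlim_tendsto_pos_mult_at_top[OF tendsto_const] mult.commute)
    then have "filterlim (\<lambda>k. (real k * t)\<^sup>2) at_top sequentially"
      by (intro filterlim_pow_at_top) auto
    then show "filterlim (\<lambda>k. 1 + (real k * t)\<^sup>2) at_top sequentially"
      by (intro filterlim_tendsto_add_at_top[OF tendsto_const])
  qed
  moreover have "bump (real k * t) = 1 - inverse (1 + (real k * t)\<^sup>2)" for k
  proof -
    have "1 + (real k * t)\<^sup>2 \<noteq> 0" by (simp add: add_nonneg_eq_0_iff)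
    then show ?thesis
      using True by (simp add: bump_def field_simps max_def)
  qed
  ultimately show ?thesis using True by simp
qed (simp add: bump_eq_0 mult_nonneg_nonpos)

lemma C1_on_bump: "C1_on G u \<Longrightarrow> C1_on G (\<lambda>x. bump (u x))"
proof (rule C1_on_compose[OF DERIV_bump])
  have "1 + (max 0 t)\<^sup>2 \<noteq> 0" for t :: real by (simp add: add_nonneg_eq_0_iff)
  then show "continuous_on UNIV (\<lambda>t::real. 2 * max 0 t / (1 + (max 0 t)\<^sup>2)\<^sup>2)"
    by (intro continuous_intros) auto
qed

lemma C1_on_scale: "C1_on G u \<Longrightarrow> C1_on G (\<lambda>x. c * u x)"
  by (intro C1_on_mult C1_on_const)

lemma C1_on_diff:
  assumes u: "C1_on G u" and v: "C1_on G v"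
  shows "C1_on G (\<lambda>x. u x - v x)"
proof (rule C1_onI)
  fix b x :: 'a assume "b \<in> Basis" "x \<in> G"
  then show "((\<lambda>t. u (x + t *\<^sub>R b) - v (x + t *\<^sub>R b)) has_real_derivative
      (pd b u x - pd b v x)) (at 0)"
    using DERIV_diff[OF C1_on_DERIV[OF u] C1_on_DERIV[OF v]] by fastforce
qed (use u v in \<open>auto intro!: continuous_intros intro: C1_on_imp_continuous_on_pd C1_on_imp_continuous_on\<close>)

text \<open>Bounded test functions converge pointwise to indicators of boxes cut with the ball, so
  \<open>h\<close> integrates to zero over each of these sets. Boxes are stable under intersection
  and generate the Borel sets, so the integral vanishes over every Borel set, which forces
  \<open>h\<close> to vanish almost everywhere.\<close>

lemma AE_eq_0_if_test_integrals_eq_0: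
  fixes h :: "'a::euclidean_space \<Rightarrow> real"
  assumes h: "set_integrable lebesgue (ball 0 s) h"
    and test: "\<And>\<phi>. C1_on UNIV \<phi> \<Longrightarrow> (\<And>x. x \<notin> ball 0 s \<Longrightarrow> \<phi> x = 0) \<Longrightarrow>
       (LINT x:ball 0 s|lebesgue. h x * \<phi> x) = 0"
  shows "AE x in lebesgue. x \<in> ball 0 s \<longrightarrow> h x = 0"
proof (cases "s > 0")
  case True
  define H where "H x = indicator (ball 0 s) x * h x" for x
  have H: "integrable lebesgue H"
    using h by (simp add: set_integrable_def H_def[abs_def])
  \<comment> \<open>A Borel representative moves the argument from \<open>lebesgue\<close> to
    \<open>lborel\<close>, where the test functions and the generated sigma-algebra live.\<close>
  obtain H' where H'[measurable]: "H' \<in> borel_measurable lborel" and ae: "AE x in lborel. H x = H' x"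
    using completion_ex_borel_measurable_real[of H lborel] H by auto
  have ae': "AE x in lebesgue. H x = H' x"
    using ae by (rule AE_completion)
  have "integrable lebesgue H'"
    using ae' by (intro integrable_cong_AE_imp[OF H]) (simp_all add: measurable_completion)
  then have iH': "integrable lborel H'"
    using integrable_completion[OF H'] by simp
  have zero: "(LINT x|lborel. H' x * \<phi> x) = 0"
    if \<phi>: "C1_on UNIV \<phi>" "\<And>x. x \<notin> ball 0 s \<Longrightarrow> \<phi> x = 0" for \<phi>
  proof -
    have [measurable]: "\<phi> \<in> borel_measurable borel"
      using C1_on_imp_continuous_on[OF \<phi>(1)] borel_measurable_continuous_onI by blast
    have "(LINT x|lborel. H' x * \<phi> x) = (LINT x|lebesgue. H' x * \<phi> x)"
      by (rule integral_completion[symmetric]) measurable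
    also have "\<dots> = (LINT x|lebesgue. H x * \<phi> x)"
    proof (rule integral_cong_AE)
      have [measurable]: "\<phi> \<in> borel_measurable lebesgue" "H' \<in> borel_measurable lebesgue"
        by (simp_all add: measurable_completion)
      have [measurable]: "H \<in> borel_measurable lebesgue"
        using H by (rule borel_measurable_integrable)
      show "(\<lambda>x. H' x * \<phi> x) \<in> borel_measurable lebesgue" "(\<lambda>x. H x * \<phi> x) \<in> borel_measurable lebesgue"
        by measurable
    qed (use ae' in auto)
    also have "\<dots> = (LINT x:ball 0 s|lebesgue. h x * \<phi> x)"
      by (simp add: set_lebesgue_integral_def H_def mult.assoc)
    finally show ?thesis using test[OF \<phi>] by simp
  qed
  \<comment> \<open>Dominated convergence with dominating function \<bar>H'\<bar>. Cutting
    \<open>A\<close> with the ball does not change the integral, because \<open>H'\<close> is almost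
    everywhere zero outside it.\<close>
  have limit: "(LINT x|lborel. H' x * indicator A x) = 0"
    if \<phi>: "\<And>k. C1_on UNIV (\<phi> k)" "\<And>x k. x \<notin> ball 0 s \<Longrightarrow> \<phi> k x = 0" "\<And>x k. \<bar>\<phi> k x\<bar> \<le> 1"
      and lim: "\<And>x. (\<lambda>k. \<phi> k x) \<longlonglongrightarrow> indicator (A \<inter> ball 0 s) x" and A: "A \<in> sets borel"
    for A and \<phi> :: "nat \<Rightarrow> 'a \<Rightarrow> real"
  proof -
    have [measurable]: "\<phi> k \<in> borel_measurable borel" for k
      using C1_on_imp_continuous_on[OF \<phi>(1)] borel_measurable_continuous_onI by blast
    have [measurable]: "A \<in> sets borel" by fact
    have "(\<lambda>k. LINT x|lborel. H' x * \<phi> k x) \<longlonglongrightarrow> (LINT x|lborel. H' x * indicator (A \<inter> ball 0 s) x)"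
    proof (rule integral_dominated_convergence[where w="\<lambda>x. \<bar>H' x\<bar>"])
      show "AE x in lborel. norm (H' x * \<phi> k x) \<le> \<bar>H' x\<bar>" for k
        using \<phi>(3) by (intro AE_I2) (simp add: abs_mult mult_left_le)
      show "AE x in lborel. (\<lambda>k. H' x * \<phi> k x) \<longlonglongrightarrow> H' x * indicator (A \<inter> ball 0 s) x"
        by (intro AE_I2 tendsto_intros lim)
      have [measurable]: "A \<inter> ball 0 s \<in> sets borel"
        using A by auto
      show "(\<lambda>x. H' x * indicator (A \<inter> ball 0 s) x) \<in> borel_measurable lborel"
        by measurable
    qed (use iH' in auto)
    then have "(LINT x|lborel. H' x * indicator (A \<inter> ball 0 s) x) = 0"
      using zero[OF \<phi>(1,2)] LIMSEQ_unique[OF tendsto_const] by fastforce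
    also have "(LINT x|lborel. H' x * indicator (A \<inter> ball 0 s) x) = (LINT x|lborel. H' x * indicator A x)"
      using ae by (intro integral_cong_AE) (auto simp: H_def indicator_def split: if_splits)
    finally show ?thesis .
  qed
  \<comment> \<open>\<open>\<beta> k\<close> exhausts the ball and \<open>\<gamma> a c k\<close> the
    box. Their product is admissible since \<open>\<beta> k\<close> already vanishes outside the
    ball.\<close>
  define \<beta> where "\<beta> k x = bump (real k * (s\<^sup>2 - (norm x)\<^sup>2))" for k and x :: 'a
  have ball_iff: "x \<in> ball 0 s \<longleftrightarrow> s\<^sup>2 - (norm x)\<^sup>2 > 0" for x :: 'a
    using True power_less_imp_less_base[of "norm x" 2 s] power_strict_mono[of "norm x" s 2] by auto
  have \<beta>0: "\<beta> k x = 0" if "x \<notin> ball 0 s" for k x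
    using that unfolding \<beta>_def ball_iff by (intro bump_eq_0) (simp add: mult_nonneg_nonpos)
  have C1\<beta>: "C1_on UNIV (\<beta> k)" for k
    unfolding \<beta>_def by (intro C1_on_bump C1_on_scale C1_on_diff C1_on_const C1_on_norm_sq)
  have lim\<beta>: "(\<lambda>k. \<beta> k x) \<longlonglongrightarrow> indicator (ball 0 s) x" for x
    using tendsto_bump[of "s\<^sup>2 - (norm x)\<^sup>2"] unfolding \<beta>_def indicator_def ball_iff by (simp add: of_bool_def)
  define \<gamma> where "\<gamma> a c k x = (\<Prod>b\<in>Basis. bump (real k * (x \<bullet> b - a \<bullet> b)) * bump (real k * (c \<bullet> b - x \<bullet> b)))"
    for a c x :: 'a and k
  have C1\<gamma>: "C1_on UNIV (\<gamma> a c k)" for a c k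
    unfolding \<gamma>_def
    by (intro C1_on_prod C1_on_mult) (intro C1_on_bump C1_on_scale C1_on_diff C1_on_const C1_on_inner)+
  have \<gamma>_range: "0 \<le> \<gamma> a c k x" "\<gamma> a c k x \<le> 1" for a c k x
    unfolding \<gamma>_def by (auto intro!: prod_nonneg prod_le_1 mult_nonneg_nonneg mult_le_one bump_range)
  have lim\<gamma>: "(\<lambda>k. \<gamma> a c k x) \<longlonglongrightarrow> indicator (box a c) x" for a c x
  proof -
    have "(\<lambda>k. \<gamma> a c k x) \<longlonglongrightarrow> (\<Prod>b\<in>Basis. (if x \<bullet> b - a \<bullet> b > 0 then 1 else 0) * (if c \<bullet> b - x \<bullet> b > 0 then 1 else 0))"
      unfolding \<gamma>_def by (intro tendsto_prod tendsto_mult tendsto_bump)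
    also have "(\<Prod>b\<in>Basis. (if x \<bullet> b - a \<bullet> b > 0 then 1 else 0) * (if c \<bullet> b - x \<bullet> b > 0 then 1 else 0))
        = (indicator (box a c) x :: real)"
    proof (cases "x \<in> box a c")
      case True
      then show ?thesis by (auto simp: mem_box intro!: prod.neutral)
    next
      case False
      then show ?thesis by (fastforce simp: mem_box intro!: prod_zero)
    qed
    finally show ?thesis .
  qed
  \<comment> \<open>The whole space is treated apart, since the complement step of the Dynkin
    induction subtracts from it.\<close>
  have UNIV0: "(LINT x|lborel. H' x * indicator UNIV x) = 0"
    by (rule limit[of \<beta>]) (use C1\<beta> \<beta>0 lim\<beta> bump_range in \<open>auto simp: \<beta>_def\<close>)
  have box0: "(LINT x|lborel. H' x * indicator (box a c) x) = 0" for a c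
  proof (rule limit[of "\<lambda>k x. \<beta> k x * \<gamma> a c k x"])
    show "\<bar>\<beta> k x * \<gamma> a c k x\<bar> \<le> 1" for k x
      using \<gamma>_range[of a c k x] bump_range[of "real k * (s\<^sup>2 - (norm x)\<^sup>2)"]
      by (simp add: abs_mult \<beta>_def mult_le_one)
    show "(\<lambda>k. \<beta> k x * \<gamma> a c k x) \<longlonglongrightarrow> indicator (box a c \<inter> ball 0 s) x" for x
      using tendsto_mult[OF lim\<beta> lim\<gamma>, of x a c] by (simp add: indicator_inter_arith mult.commute)
  qed (auto simp: \<beta>0 intro!: C1_on_mult C1\<beta> C1\<gamma>)
  have "(LINT x|lborel. H' x * indicator A x) = 0" if "A \<in> sets borel" for A
  proof -
    have "Int_stable (range (\<lambda>(a, c). box a c :: 'a set))"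
      by (auto simp: Int_stable_def box_Int_box)
    moreover have "range (\<lambda>(a, c). box a c :: 'a set) \<subseteq> Pow UNIV"
      by simp
    moreover have "A \<in> sigma_sets UNIV (range (\<lambda>(a, c). box a c :: 'a set))"
      using that unfolding borel_eq_box by simp
    ultimately show ?thesis
    proof (induction rule: sigma_sets_induct_disjoint)
      show "\<And>A. A \<in> range (\<lambda>(a, c). box a c) \<Longrightarrow> (LINT x|lborel. H' x * indicator A x) = 0"
        using box0 by auto
      case (compl A)
      then have A[measurable]: "A \<in> sets borel"
        unfolding borel_eq_box by simp
      have "(LINT x|lborel. H' x * indicator (UNIV - A) x) = (LINT x|lborel. H' x * indicator UNIV x - H' x * indicator A x)"
        by (intro Bochner_Integration.integral_cong) (auto simp: indicator_def)
      also have "\<dots> = (LINT x|lborel. H' x * indicator UNIV x) - (LINT x|lborel. H' x * indicator A x)"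
        using iH' by (intro Bochner_Integration.integral_diff integrable_real_mult_indicator) auto
      finally show ?case using compl UNIV0 by simp
    next
      case (union A)
      then have A[measurable]: "A i \<in> sets borel" for i
        unfolding borel_eq_box by auto
      have "(LINT x:(\<Union>i. A i)|lborel. H' x) = (\<Sum>i. LINT x:A i|lborel. H' x)"
        using union(1) iH' A
        by (intro lebesgue_integral_countable_add)
           (auto simp: disjoint_family_on_def set_integrable_def intro!: integrable_mult_indicator[where 'b=real, simplified])
      then show ?case
        using union(3) by (simp add: set_lebesgue_integral_def mult.commute)
    qed simp_all
  qed
  then have "AE x in lborel. H' x = 0"
    using iH' by (intro sigma_finite_measure.density_zero[OF sigma_finite_lborel]) (auto simp: set_lebesgue_integral_def mult.commute)
  then have "AE x in lborel. x \<in> ball 0 s \<longrightarrow> h x = 0"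
    using ae by eventually_elim (auto simp: H_def)
  then show ?thesis by (rule AE_completion)
next
  case False
  then have "x \<notin> ball 0 s" for x :: 'a
    using norm_ge_zero[of x] by (simp del: norm_ge_zero)
  then show ?thesis by (simp del: mem_ball)
qed

section \<open>Dilatation of the adjoint, and differentiability from partial derivatives\<close>

text \<open>A map and its adjoint have the same singular values; the argument avoids them. If A z =
  v, then 1 \<le> |A* v| |z| by Cauchy-Schwarz. For y = A* u one has |y|^2 \<le> |A y|, and the
  dilatation bound compares A y with A z, giving |y| |z| \<le> K. If A is not injective, the bound
  forces A = 0.\<close>

lemma adjoint_quasiconformal:
  fixes A :: "'a::euclidean_space \<Rightarrow> 'a"
  assumes lin: "linear A" and K: "K \<ge> 0"
    and A: "\<And>h k. norm h = 1 \<Longrightarrow> norm k = 1 \<Longrightarrow> norm (A h) \<le> K * norm (A k)"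
    and v: "norm v = 1" and u: "norm u = 1"
  shows "norm (adjoint A u) \<le> K * norm (adjoint A v)"
proof -
  \<comment> \<open>The homogeneous form of the hypothesis, valid also for zero vectors.\<close>
  have hom: "norm (A h) * norm k \<le> K * norm (A k) * norm h" for h k
  proof (cases "h = 0 \<or> k = 0")
    case True
    then show ?thesis using lin K by (auto simp: linear_0)
  next
    case False
    then have "norm (A (h /\<^sub>R norm h)) \<le> K * norm (A (k /\<^sub>R norm k))"
      by (intro A) auto
    with False show ?thesis
      by (simp add: linear_scale[OF lin] field_simps)
  qed
  show ?thesis
  proof (cases "inj A")
    case True
    then obtain z where z: "A z = v"
      using linear_injective_imp_surjective[OF lin] by (metis surjD)
    define y where "y = adjoint A u"
    have "1 = adjoint A v \<bullet> z"
      using z v by (simp add: adjoint_clauses[OF lin] norm_eq_1)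
    also have "\<dots> \<le> norm (adjoint A v) * norm z"
      by (rule norm_cauchy_schwarz)
    finally have z1: "1 \<le> norm (adjoint A v) * norm z" .
    have "(norm y)\<^sup>2 = u \<bullet> A y"
      by (simp add: y_def power2_norm_eq_inner adjoint_clauses[OF lin] inner_commute)
    also have "\<dots> \<le> norm (A y)"
      using norm_cauchy_schwarz[of u "A y"] u by simp
    finally have "(norm y)\<^sup>2 * norm z \<le> norm (A y) * norm z"
      by (rule mult_right_mono) simp
    also have "\<dots> \<le> K * norm y"
      using hom[of y z] z v by simp
    finally have y1: "(norm y)\<^sup>2 * norm z \<le> K * norm y" .
    have "norm y * norm z \<le> K"
    proof (cases "y = 0")
      case False
      then show ?thesis using y1 by (simp add: power2_eq_square field_simps)
    qed (use K in simp)
    then have "norm y * norm z * norm (adjoint A v) \<le> K * norm (adjoint A v)"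
      by (rule mult_right_mono) simp
    moreover have "norm y * 1 \<le> norm y * (norm (adjoint A v) * norm z)"
      using z1 by (rule mult_left_mono) simp
    ultimately show ?thesis by (simp add: y_def mult_ac)
  next
    case False
    then obtain k where "A k = 0" "k \<noteq> 0"
      using linear_injective_0[OF lin] by blast
    then have "A h = 0" for h
      using hom[of h k] by (simp add: mult_le_0_iff)
    then have "adjoint A w = 0" for w
      using adjoint_clauses(1)[OF lin, of "adjoint A w" w] by simp
    then show ?thesis using K by simp
  qed
qed

text \<open>The coordinates are moved one at a time; the mean value theorem handles each step.\<close>

lemma has_derivative_if_continuous_line_derivatives:
  fixes g :: "'a::euclidean_space \<Rightarrow> real"
  assumes G: "open G" and x: "x \<in> G"
    and der: "\<And>b x. b \<in> Basis \<Longrightarrow> x \<in> G \<Longrightarrow> ((\<lambda>t. g (x + t *\<^sub>R b)) has_real_derivative D b x) (at 0)"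
    and cont: "\<And>b. b \<in> Basis \<Longrightarrow> continuous_on G (D b)"
  shows "(g has_derivative (\<lambda>h. \<Sum>b\<in>Basis. (h \<bullet> b) * D b x)) (at x)"
proof -
  have bl: "bounded_linear (\<lambda>h. \<Sum>b\<in>Basis. (h \<bullet> b) * D b x)"
    by (intro bounded_linear_sum bounded_linear_mult_const bounded_linear_inner_left)
  \<comment> \<open>Induction on the set \<open>B\<close> of coordinates already moved. The bound on
    the sum of \<bar>h \<bullet> b\<bar> keeps every intermediate point inside
    \<open>ball x d\<close>, where the partial derivatives vary by at most \<open>e\<close>.\<close>
  have step: "\<bar>g (y + (\<Sum>b\<in>B. (h \<bullet> b) *\<^sub>R b)) - g y - (\<Sum>b\<in>B. (h \<bullet> b) * D b x)\<bar> \<le> e * (\<Sum>b\<in>B. \<bar>h \<bullet> b\<bar>)"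
    if "finite B" "B \<subseteq> Basis" and e: "\<And>b z. b \<in> Basis \<Longrightarrow> z \<in> ball x d \<Longrightarrow> \<bar>D b z - D b x\<bar> \<le> e"
      and sub: "ball x d \<subseteq> G" and "norm (y - x) + (\<Sum>b\<in>B. \<bar>h \<bullet> b\<bar>) < d" for B e d y h
    using that(1,2,5)
  proof (induction B rule: finite_induct)
    case (insert b B)
    let ?y = "y + (\<Sum>b\<in>B. (h \<bullet> b) *\<^sub>R b)"
    have b: "b \<in> Basis" using insert by simp
    have "norm (\<Sum>b\<in>B. (h \<bullet> b) *\<^sub>R b) \<le> (\<Sum>b\<in>B. \<bar>h \<bullet> b\<bar>)"
      using insert(4) by (intro sum_norm_le) auto
    then have yb: "norm (?y - x) + \<bar>h \<bullet> b\<bar> < d"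
      using insert(1,2,5) norm_triangle_ineq[of "y - x" "\<Sum>b\<in>B. (h \<bullet> b) *\<^sub>R b"] by (simp add: algebra_simps)
    have in_ball: "?y + t *\<^sub>R b \<in> ball x d" if "\<bar>t\<bar> \<le> \<bar>h \<bullet> b\<bar>" for t
    proof -
      have "norm (?y + t *\<^sub>R b - x) \<le> norm (?y - x) + norm (t *\<^sub>R b)"
        using norm_triangle_ineq[of "?y - x" "t *\<^sub>R b"] by (simp add: algebra_simps)
      then show ?thesis using yb that b by (simp add: dist_norm norm_minus_commute)
    qed
    have der': "((\<lambda>t. g (?y + t *\<^sub>R b)) has_real_derivative D b (?y + t *\<^sub>R b)) (at t)" if "\<bar>t\<bar> \<le> \<bar>h \<bullet> b\<bar>" for t
      using in_ball[OF that] sub by (intro DERIV_line_shift[OF der[OF b]]) auto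
    have "\<exists>t. \<bar>t\<bar> \<le> \<bar>h \<bullet> b\<bar> \<and> g (?y + (h \<bullet> b) *\<^sub>R b) - g ?y = (h \<bullet> b) * D b (?y + t *\<^sub>R b)"
    proof -
      consider "h \<bullet> b = 0" | "h \<bullet> b > 0" | "h \<bullet> b < 0" by linarith
      then show ?thesis
      proof cases
        case 2
        have "\<And>t. 0 \<le> t \<Longrightarrow> t \<le> h \<bullet> b \<Longrightarrow> ((\<lambda>t. g (?y + t *\<^sub>R b)) has_real_derivative D b (?y + t *\<^sub>R b)) (at t)"
          by (rule der') linarith
        from MVT2[OF 2 this] obtain z where "0 < z" "z < h \<bullet> b" "g (?y + (h \<bullet> b) *\<^sub>R b) - g (?y + 0 *\<^sub>R b) = (h \<bullet> b - 0) * D b (?y + z *\<^sub>R b)"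
          by blast
        then show ?thesis by (intro exI[of _ z]) auto
      next
        case 3
        have "\<And>t. h \<bullet> b \<le> t \<Longrightarrow> t \<le> 0 \<Longrightarrow> ((\<lambda>t. g (?y + t *\<^sub>R b)) has_real_derivative D b (?y + t *\<^sub>R b)) (at t)"
          by (rule der') linarith
        from MVT2[OF 3 this] obtain z where "h \<bullet> b < z" "z < 0" "g (?y + 0 *\<^sub>R b) - g (?y + (h \<bullet> b) *\<^sub>R b) = (0 - h \<bullet> b) * D b (?y + z *\<^sub>R b)"
          by blast
        then show ?thesis by (intro exI[of _ z]) auto
      qed auto
    qed
    then obtain t where t: "\<bar>t\<bar> \<le> \<bar>h \<bullet> b\<bar>" "g (?y + (h \<bullet> b) *\<^sub>R b) - g ?y = (h \<bullet> b) * D b (?y + t *\<^sub>R b)"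
      by blast
    have "\<bar>g (?y + (h \<bullet> b) *\<^sub>R b) - g ?y - (h \<bullet> b) * D b x\<bar> = \<bar>h \<bullet> b\<bar> * \<bar>D b (?y + t *\<^sub>R b) - D b x\<bar>"
      unfolding t(2) abs_mult[symmetric] by (simp add: algebra_simps)
    also have "\<dots> \<le> \<bar>h \<bullet> b\<bar> * e"
      by (intro mult_left_mono e b in_ball t) simp
    finally have 1: "\<bar>g (?y + (h \<bullet> b) *\<^sub>R b) - g ?y - (h \<bullet> b) * D b x\<bar> \<le> e * \<bar>h \<bullet> b\<bar>"
      by (simp add: mult.commute)
    have "norm (y - x) + (\<Sum>b\<in>B. \<bar>h \<bullet> b\<bar>) < d"
      using insert by simp
    then have 2: "\<bar>g ?y - g y - (\<Sum>b\<in>B. (h \<bullet> b) * D b x)\<bar> \<le> e * (\<Sum>b\<in>B. \<bar>h \<bullet> b\<bar>)"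
      using insert by simp
    have 3: "y + (\<Sum>b\<in>insert b B. (h \<bullet> b) *\<^sub>R b) = ?y + (h \<bullet> b) *\<^sub>R b"
      using insert by (simp add: algebra_simps)
    show ?case
      unfolding 3 using 1 2 insert(1,2) by (simp add: algebra_simps)
  qed simp
  show ?thesis
    unfolding has_derivative_at_alt
  proof (intro conjI allI impI bl)
    fix e :: real assume e: "e > 0"
    \<comment> \<open>The sum of the absolute coordinates is at most the dimension times the norm,
      so both the tolerance and, below, the radius are divided by the dimension.\<close>
    define e' where "e' = e / DIM('a)"
    have e': "e' > 0" using e by (simp add: e'_def)
    have "\<forall>\<^sub>F z in nhds x. \<bar>D b z - D b x\<bar> \<le> e'" if "b \<in> Basis" for b
    proof -
      have "(D b \<longlongrightarrow> D b x) (nhds x)"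
        using cont[OF that] G x by (metis continuous_on_eq_continuous_at isCont_def tendsto_at_iff_tendsto_nhds)
      then show ?thesis
        using e' by (auto simp: dist_real_def dest!: tendstoD[where e=e'] elim!: eventually_mono)
    qed
    then have "\<forall>\<^sub>F z in nhds x. z \<in> G \<and> (\<forall>b\<in>Basis. \<bar>D b z - D b x\<bar> \<le> e')"
      using eventually_nhds_in_open[OF G x] by (simp add: eventually_conj_iff eventually_ball_finite_distrib)
    then obtain d where d: "d > 0" "\<And>z. dist z x < d \<Longrightarrow> z \<in> G \<and> (\<forall>b\<in>Basis. \<bar>D b z - D b x\<bar> \<le> e')"
      unfolding eventually_nhds_metric by blast
    show "\<exists>d>0. \<forall>y. norm (y - x) < d \<longrightarrow> norm (g y - g x - (\<Sum>b\<in>Basis. ((y - x) \<bullet> b) * D b x)) \<le> e * norm (y - x)"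
    proof (intro exI[of _ "d / DIM('a)"] conjI allI impI)
      fix y assume y: "norm (y - x) < d / DIM('a)"
      have s: "(\<Sum>b\<in>Basis. \<bar>(y - x) \<bullet> b\<bar>) \<le> DIM('a) * norm (y - x)"
        using sum_bounded_above[of Basis "\<lambda>b. \<bar>(y - x) \<bullet> b\<bar>" "norm (y - x)"] Basis_le_norm by blast
      have "DIM('a) * norm (y - x) < d"
        using y by (simp add: field_simps)
      then have "\<bar>g (x + (\<Sum>b\<in>Basis. ((y - x) \<bullet> b) *\<^sub>R b)) - g x - (\<Sum>b\<in>Basis. ((y - x) \<bullet> b) * D b x)\<bar>
          \<le> e' * (\<Sum>b\<in>Basis. \<bar>(y - x) \<bullet> b\<bar>)"
        using s d(2) by (intro step[where d=d]) (auto simp: dist_commute)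
      also have "\<dots> \<le> e' * (DIM('a) * norm (y - x))"
        using s e' by (intro mult_left_mono) auto
      also have "\<dots> = e * norm (y - x)"
        by (simp add: e'_def)
      finally show "norm (g y - g x - (\<Sum>b\<in>Basis. ((y - x) \<bullet> b) * D b x)) \<le> e * norm (y - x)"
        by (simp add: euclidean_representation)
    qed (use d in simp)
  qed
qed

section \<open>The submean value property\<close>

text \<open>With \<open>E\<close> an antiderivative of \<eta>, the function E(\<rho>^2) - E(|x|^2)
  has gradient -2 \<eta>(|x|^2) x. Integrating by parts against it turns the integral into half the
  integral of this function times the divergence of the field \<open>D\<close>, and both factors are
  nonnegative. Weights in |x|^2 rather than |x| are differentiable at the origin.\<close>

lemma weighted_radial_derivative_nonneg:
  fixes D D' :: "'a::euclidean_space \<Rightarrow> 'a \<Rightarrow> real"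
  assumes D: "\<And>b. b \<in> Basis \<Longrightarrow> continuous_on (ball 0 1) (D b)"
    and D': "\<And>b. b \<in> Basis \<Longrightarrow> continuous_on (ball 0 1) (D' b)"
    and der: "\<And>b x. b \<in> Basis \<Longrightarrow> x \<in> ball 0 1 \<Longrightarrow> ((\<lambda>t. D b (x + t *\<^sub>R b)) has_real_derivative D' b x) (at 0)"
    and lap: "\<And>x. x \<in> ball 0 1 \<Longrightarrow> 0 \<le> (\<Sum>b\<in>Basis. D' b x)"
    and \<eta>: "continuous_on UNIV \<eta>" "\<And>s. 0 \<le> \<eta> s" "\<And>s. \<rho>\<^sup>2 \<le> s \<Longrightarrow> \<eta> s = 0"
    and \<rho>: "0 \<le> \<rho>" "\<rho> < 1"
  shows "0 \<le> (LINT x:ball 0 1|lborel. \<eta> ((norm x)\<^sup>2) * (\<Sum>b\<in>Basis. (x \<bullet> b) * D b x))"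
proof -
  have "\<exists>E. \<forall>x. - \<infinity> < ereal x \<longrightarrow> ereal x < \<infinity> \<longrightarrow> (E has_vector_derivative \<eta> x) (at x)"
    using \<eta>(1) by (intro einterval_antiderivative) (auto simp: continuous_on_eq_continuous_at)
  then obtain E where E: "\<And>s. (E has_real_derivative \<eta> s) (at s)"
    by (auto simp: has_real_derivative_iff_has_vector_derivative)
  \<comment> \<open>\<open>E\<close> is nondecreasing because \<eta> is nonnegative, and constant
    beyond \<open>\<rho>\<^sup>2\<close>. Hence \<phi> is nonnegative and supported in
    \<open>cball 0 \<rho>\<close>, a compact subset of the unit ball.\<close>
  define \<phi> where "\<phi> x = E (\<rho>\<^sup>2) - E ((norm x)\<^sup>2)" for x :: 'a
  have mono: "E s \<le> E t" if "s \<le> t" for s t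
    using that by (rule DERIV_nonneg_imp_nondecreasing) (use E \<eta>(2) in blast)
  have const: "E s = E (\<rho>\<^sup>2)" if "\<rho>\<^sup>2 \<le> s" for s
  proof -
    have "E s \<le> E (\<rho>\<^sup>2)"
      using that by (rule DERIV_nonpos_imp_nonincreasing) (use E \<eta>(3) in \<open>metis order_refl\<close>)
    then show ?thesis using mono[OF that] by simp
  qed
  have \<phi>_nonneg: "0 \<le> \<phi> x" for x
    using mono[of "(norm x)\<^sup>2" "\<rho>\<^sup>2"] const[of "(norm x)\<^sup>2"] by (cases "(norm x)\<^sup>2 \<le> \<rho>\<^sup>2") (auto simp: \<phi>_def)
  have E1: "C1_on UNIV (\<lambda>x::'a. E ((norm x)\<^sup>2))"
    by (rule C1_on_compose[OF E \<eta>(1) C1_on_norm_sq])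
  have "{x. \<phi> x \<noteq> 0} \<subseteq> cball 0 \<rho>"
  proof
    fix x assume "x \<in> {x. \<phi> x \<noteq> 0}"
    then have "(norm x)\<^sup>2 < \<rho>\<^sup>2" using const[of "(norm x)\<^sup>2"] by (force simp: \<phi>_def)
    then show "x \<in> cball 0 \<rho>" using \<rho> power_less_imp_less_base by fastforce
  qed
  then have cl: "closure {x. \<phi> x \<noteq> 0} \<subseteq> cball 0 \<rho>"
    by (intro closure_minimal) auto
  then have "compact (closure {x. \<phi> x \<noteq> 0})"
    by (meson bounded_cball bounded_subset closed_closure compact_eq_bounded_closed)
  moreover have "C1_on UNIV \<phi>"
    unfolding \<phi>_def by (intro C1_on_diff C1_on_const E1)
  ultimately have test: "test_fn (ball 0 1) \<phi>"
    using cl \<rho> by (fastforce simp: test_fn_def)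
  have pd\<phi>: "pd b \<phi> x = - (\<eta> ((norm x)\<^sup>2) * (2 * (x \<bullet> b)))" for b x
  proof (rule pd_eqI)
    have "((\<lambda>t. E ((norm (x + t *\<^sub>R b))\<^sup>2)) has_real_derivative \<eta> ((norm x)\<^sup>2) * (2 * (x \<bullet> b))) (at 0)"
      by (rule DERIV_chain2[OF _ DERIV_norm_sq_line]) (simp add: E)
    then show "((\<lambda>t. \<phi> (x + t *\<^sub>R b)) has_real_derivative - (\<eta> ((norm x)\<^sup>2) * (2 * (x \<bullet> b)))) (at 0)"
      unfolding \<phi>_def by (auto intro!: derivative_eq_intros)
  qed
  note ibp = integration_by_parts_test_fn[OF open_ball _ test D D' der]
  have "-2 * (LINT x:ball 0 1|lborel. \<eta> ((norm x)\<^sup>2) * (\<Sum>b\<in>Basis. (x \<bullet> b) * D b x))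
      = (LINT x:ball 0 1|lborel. (\<Sum>b\<in>Basis. D b x * pd b \<phi> x))"
    unfolding pd\<phi> set_integral_mult_right[symmetric] by (simp add: sum_distrib_left sum_negf mult_ac)
  also have "\<dots> = (\<Sum>b\<in>Basis. (LINT x:ball 0 1|lborel. D b x * pd b \<phi> x))"
    unfolding set_lebesgue_integral_def scaleR_sum_right
    using ibp(1) by (intro Bochner_Integration.integral_sum) (auto simp: set_integrable_def)
  also have "\<dots> = - (\<Sum>b\<in>Basis. (LINT x:ball 0 1|lborel. D' b x * \<phi> x))"
    using ibp(3) by (simp add: sum_negf)
  also have "(\<Sum>b\<in>Basis. (LINT x:ball 0 1|lborel. D' b x * \<phi> x)) = (LINT x:ball 0 1|lborel. (\<Sum>b\<in>Basis. D' b x * \<phi> x))"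
    unfolding set_lebesgue_integral_def scaleR_sum_right
    using ibp(2) by (intro Bochner_Integration.integral_sum[symmetric]) (auto simp: set_integrable_def)
  finally have "2 * (LINT x:ball 0 1|lborel. \<eta> ((norm x)\<^sup>2) * (\<Sum>b\<in>Basis. (x \<bullet> b) * D b x))
     = (LINT x:ball 0 1|lborel. (\<Sum>b\<in>Basis. D' b x * \<phi> x))" by simp
  moreover have "0 \<le> (LINT x:ball 0 1|lborel. (\<Sum>b\<in>Basis. D' b x * \<phi> x))"
    unfolding set_lebesgue_integral_def sum_distrib_right[symmetric]
    using lap \<phi>_nonneg by (intro Bochner_Integration.integral_nonneg) (auto simp: indicator_def)
  ultimately show ?thesis by simp
qed

text \<open>The function A(t), the integral of \<eta>(|x|^2) g(t x), has as derivative the weighted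
  integral of the inner product of x with the gradient of g at t x. This is nonnegative by the
  preceding lemma, and the claim is A(0) \<le> A(1).\<close>

lemma weighted_submean:
  fixes g :: "'a::euclidean_space \<Rightarrow> real" and D D' :: "'a \<Rightarrow> 'a \<Rightarrow> real"
  assumes g: "continuous_on (ball 0 1) g"
    and D: "\<And>b. b \<in> Basis \<Longrightarrow> continuous_on (ball 0 1) (D b)"
    and D': "\<And>b. b \<in> Basis \<Longrightarrow> continuous_on (ball 0 1) (D' b)"
    and der: "\<And>b x. b \<in> Basis \<Longrightarrow> x \<in> ball 0 1 \<Longrightarrow> ((\<lambda>t. g (x + t *\<^sub>R b)) has_real_derivative D b x) (at 0)"
    and der2: "\<And>b x. b \<in> Basis \<Longrightarrow> x \<in> ball 0 1 \<Longrightarrow> ((\<lambda>t. D b (x + t *\<^sub>R b)) has_real_derivative D' b x) (at 0)"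
    and lap: "\<And>x. x \<in> ball 0 1 \<Longrightarrow> 0 \<le> (\<Sum>b\<in>Basis. D' b x)"
    and \<eta>: "continuous_on UNIV \<eta>" "\<And>s. 0 \<le> \<eta> s" "\<And>s. \<rho>\<^sup>2 \<le> s \<Longrightarrow> \<eta> s = 0"
    and \<rho>: "0 < \<rho>" "\<rho> < 1"
  shows "g 0 * (LINT x|lborel. \<eta> ((norm (x::'a))\<^sup>2)) \<le> (LINT x|lborel. \<eta> ((norm x)\<^sup>2) * g x)"
proof -
  \<comment> \<open>With this choice (1 + \<delta>) \<rho> = 1 - \<delta>^2 < 1, so
    \<open>t *\<^sub>R x\<close> stays in the unit ball for \<open>t\<close> in a neighbourhood of
    the whole interval from 0 to 1, endpoints included.\<close>
  define \<delta> where "\<delta> = 1 - \<rho>"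
  have \<delta>: "\<delta> > 0" using \<rho> by (simp add: \<delta>_def)
  have \<eta>0: "\<eta> ((norm x)\<^sup>2) = 0" if "x \<notin> cball 0 \<rho>" for x :: 'a
    using that \<rho> by (intro \<eta>(3) power_mono) auto
  have in_ball: "t *\<^sub>R x \<in> ball 0 1" if "\<bar>t\<bar> \<le> 1 + \<delta>" "x \<in> cball 0 \<rho>" for t and x :: 'a
  proof -
    have "\<bar>t\<bar> * norm x \<le> (1 + \<delta>) * \<rho>"
      using that \<rho> by (intro mult_mono) auto
    also have "\<dots> = 1 - \<delta>\<^sup>2"
      by (simp add: \<delta>_def algebra_simps power2_eq_square)
    also have "\<dots> < 1" using \<delta> by simp
    finally show ?thesis by simp
  qed
  define T where "T = {-(1 + \<delta>)..1 + \<delta>} \<times> cball (0::'a) \<rho>"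
  have T: "compact T" unfolding T_def by (intro compact_Times) auto
  define F where "F t x = \<eta> ((norm x)\<^sup>2) * g (t *\<^sub>R x)" for t x
  define F' where "F' t x = \<eta> ((norm x)\<^sup>2) * (\<Sum>b\<in>Basis. (x \<bullet> b) * D b (t *\<^sub>R x))" for t x
  \<comment> \<open>Nothing is known of \<open>w\<close> outside the unit ball; the weight vanishes
    before \<open>t *\<^sub>R x\<close> can leave it.\<close>
  have cont: "continuous_on UNIV (\<lambda>x. \<eta> ((norm x)\<^sup>2) * w (t *\<^sub>R x))"
    if w: "continuous_on (ball 0 1) w" and t: "\<bar>t\<bar> < 1 + \<delta>" for t and w :: "'a \<Rightarrow> real"
  proof -
    define G where "G = (\<lambda>x::'a. t *\<^sub>R x) -` ball 0 1"
    have G: "open G"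
      unfolding G_def by (intro open_vimage open_ball continuous_intros)
    have sub: "cball 0 \<rho> \<subseteq> G"
      using in_ball[of t] t by (auto simp: G_def)
    have "continuous_on G (\<lambda>x. \<eta> ((norm x)\<^sup>2) * w (t *\<^sub>R x))"
      by (intro continuous_intros continuous_on_compose2[OF \<eta>(1)] continuous_on_compose2[OF w])
         (auto simp: G_def)
    then have "continuous_on UNIV (\<lambda>x. if x \<in> G then \<eta> ((norm x)\<^sup>2) * w (t *\<^sub>R x) else 0)"
      by (rule continuous_on_zero_extension[OF G compact_cball sub]) (simp add: \<eta>0)
    moreover have "\<eta> ((norm x)\<^sup>2) = 0" if "x \<notin> G" for x
      using sub \<eta>0[of x] that by blast
    then have "(\<lambda>x. if x \<in> G then \<eta> ((norm x)\<^sup>2) * w (t *\<^sub>R x) else 0) = (\<lambda>x. \<eta> ((norm x)\<^sup>2) * w (t *\<^sub>R x))"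
      by (auto simp: fun_eq_iff)
    ultimately show ?thesis by (simp only:)
  qed
  have contF': "continuous_on UNIV (F' t)" if "\<bar>t\<bar> < 1 + \<delta>" for t
  proof -
    have "continuous_on UNIV (\<lambda>x. \<Sum>b\<in>Basis. (x \<bullet> b) * (\<eta> ((norm x)\<^sup>2) * D b (t *\<^sub>R x)))"
      by (intro continuous_intros cont D that)
    also have "(\<lambda>x. \<Sum>b\<in>Basis. (x \<bullet> b) * (\<eta> ((norm x)\<^sup>2) * D b (t *\<^sub>R x))) = F' t"
      by (simp add: F'_def sum_distrib_left mult_ac fun_eq_iff)
    finally show ?thesis .
  qed
  have "continuous_on T (\<lambda>(t, x). F' t x)"
    unfolding F'_def case_prod_beta
    by (intro continuous_intros continuous_on_compose2[OF \<eta>(1)] continuous_on_compose2[OF D])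
       (use in_ball in \<open>auto simp: T_def\<close>)
  then have "bounded ((\<lambda>(t, x). F' t x) ` T)"
    by (intro compact_imp_bounded compact_continuous_image T)
  then obtain M where "\<forall>y\<in>(\<lambda>(t, x). F' t x) ` T. norm y \<le> M"
    unfolding bounded_iff by blast
  then have M: "\<And>z. z \<in> T \<Longrightarrow> norm ((\<lambda>(t, x). F' t x) z) \<le> M"
    by blast
  have F'0: "F' t x = 0" if "x \<notin> cball 0 \<rho>" for t x
    using \<eta>0[OF that] by (simp add: F'_def)
  have bound: "\<bar>F' t x\<bar> \<le> max 0 M" if "\<bar>t\<bar> < 1 + \<delta>" for t x
  proof (cases "x \<in> cball 0 \<rho>")
    case True
    with that have "(t, x) \<in> T" by (auto simp: T_def)
    then show ?thesis using M[of "(t, x)"] by simp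
  qed (simp add: F'0)
  have derF: "((\<lambda>t. F t x) has_real_derivative F' t x) (at t)" if t: "\<bar>t\<bar> < 1 + \<delta>" for t x
  proof (cases "x \<in> cball 0 \<rho>")
    case True
    have "t *\<^sub>R x \<in> ball 0 1" using in_ball t True by simp
    \<comment> \<open>The direction \<open>x\<close> is not a coordinate direction, so the chain
      rule needs the full derivative, obtained from the continuous partial derivatives.\<close>
    then have "(g has_derivative (\<lambda>h. \<Sum>b\<in>Basis. (h \<bullet> b) * D b (t *\<^sub>R x))) (at (t *\<^sub>R x))"
      by (intro has_derivative_if_continuous_line_derivatives[OF open_ball _ der D])
    moreover have "((\<lambda>t. t *\<^sub>R x) has_derivative (\<lambda>h. h *\<^sub>R x)) (at t)"
      by (intro derivative_intros)
    ultimately have "((\<lambda>t. g (t *\<^sub>R x)) has_derivative (\<lambda>h. \<Sum>b\<in>Basis. ((h *\<^sub>R x) \<bullet> b) * D b (t *\<^sub>R x))) (at t)"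
      using has_derivative_compose by fastforce
    also have "(\<lambda>h. \<Sum>b\<in>Basis. ((h *\<^sub>R x) \<bullet> b) * D b (t *\<^sub>R x)) = (*) (\<Sum>b\<in>Basis. (x \<bullet> b) * D b (t *\<^sub>R x))"
      by (auto simp: sum_distrib_left sum_distrib_right mult_ac fun_eq_iff)
    finally have "((\<lambda>t. g (t *\<^sub>R x)) has_real_derivative (\<Sum>b\<in>Basis. (x \<bullet> b) * D b (t *\<^sub>R x))) (at t)"
      by (simp add: has_field_derivative_def)
    then show ?thesis
      unfolding F_def F'_def by (rule DERIV_cmult)
  next
    case False
    then show ?thesis by (simp add: F_def F'_def \<eta>0)
  qed
  define A where "A t = (LINT x|lborel. F t x)" for t
  have derA: "(A has_real_derivative (LINT x|lborel. F' t x)) (at t)" if t: "0 \<le> t" "t \<le> 1" for t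
    unfolding A_def
  proof (rule DERIV_integral_lborel[OF \<delta> compact_cball[of 0 \<rho>]])
    fix s x assume s: "\<bar>s - t\<bar> < \<delta>"
    then have s1: "\<bar>s\<bar> < 1 + \<delta>" using t \<delta> by linarith
    show "((\<lambda>t. F t x) has_real_derivative F' s x) (at s)" by (rule derF[OF s1])
    show "\<bar>F' s x\<bar> \<le> max 0 M" by (rule bound[OF s1])
    show "F' s x = 0" if "x \<notin> cball 0 \<rho>" by (rule F'0[OF that])
    show "integrable lborel (F s)"
      unfolding F_def
      by (rule integrable_continuous_compact_support[OF cont[OF g s1] compact_cball[of 0 \<rho>]])
         (simp add: \<eta>0 del: mem_cball)
  next
    show "F' t \<in> borel_measurable borel"
      using contF'[of t] t \<delta> by (intro borel_measurable_continuous_onI) auto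
  qed
  have nonneg: "0 \<le> (LINT x|lborel. F' t x)" if t: "0 < t" "t \<le> 1" for t
  proof -
    have tb: "t *\<^sub>R x \<in> ball 0 1" if "x \<in> ball 0 1" for x :: 'a
      using t that mult_le_less_imp_less[of t 1 "norm x" 1] by (cases "x = 0") auto
    \<comment> \<open>The preceding lemma is applied to the gradient of
      \<open>g (t *\<^sub>R x)\<close>, whose divergence is t^2 times the Laplacian of
      \<open>g\<close> at \<open>t *\<^sub>R x\<close>. The surplus factor t > 0 is divided out
      afterwards.\<close>
    have "0 \<le> (LINT x:ball 0 1|lborel. \<eta> ((norm x)\<^sup>2) * (\<Sum>b\<in>Basis. (x \<bullet> b) * (t * D b (t *\<^sub>R x))))"
    proof (rule weighted_radial_derivative_nonneg[OF _ _ _ _ \<eta>])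
      fix b x :: 'a assume b: "b \<in> Basis"
      show "continuous_on (ball 0 1) (\<lambda>x. t * D b (t *\<^sub>R x))" "continuous_on (ball 0 1) (\<lambda>x. t\<^sup>2 * D' b (t *\<^sub>R x))"
        using tb b by (auto intro!: continuous_intros continuous_on_compose2[OF D] continuous_on_compose2[OF D'])
      assume x: "x \<in> ball 0 1"
      have "((\<lambda>s. D b (t *\<^sub>R x + (t * s) *\<^sub>R b)) has_real_derivative D' b (t *\<^sub>R x) * t) (at 0)"
      proof (rule DERIV_chain2[where f="\<lambda>r. D b (t *\<^sub>R x + r *\<^sub>R b)" and g="\<lambda>s. t * s"])
        show "((*) t has_real_derivative t) (at 0)"
          by (rule DERIV_cmult_Id)
      qed (use der2[OF b tb[OF x]] in simp)
      from DERIV_cmult[OF this, of t]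
      show "((\<lambda>s. t * D b (t *\<^sub>R (x + s *\<^sub>R b))) has_real_derivative t\<^sup>2 * D' b (t *\<^sub>R x)) (at 0)"
        by (simp add: scaleR_add_right power2_eq_square mult_ac)
    next
      fix x :: 'a assume "x \<in> ball 0 1"
      then show "0 \<le> (\<Sum>b\<in>Basis. t\<^sup>2 * D' b (t *\<^sub>R x))"
        using lap[OF tb] by (simp add: sum_distrib_left[symmetric])
    qed (use \<rho> in auto)
    also have "\<dots> = (LINT x|lborel. t * F' t x)"
      unfolding set_lebesgue_integral_def
    proof (intro Bochner_Integration.integral_cong refl)
      fix x :: 'a
      show "indicator (ball 0 1) x *\<^sub>R (\<eta> ((norm x)\<^sup>2) * (\<Sum>b\<in>Basis. (x \<bullet> b) * (t * D b (t *\<^sub>R x)))) = t * F' t x"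
        using \<rho> \<eta>0[of x] by (cases "x \<in> ball 0 1") (auto simp: F'_def sum_distrib_left mult_ac)
    qed
    finally show ?thesis using t by (simp add: zero_le_mult_iff)
  qed
  have "A 0 \<le> A 1"
  proof (rule DERIV_nonneg_imp_increasing_open[of 0 1 A])
    show "\<exists>y. (A has_real_derivative y) (at t) \<and> 0 \<le> y" if "0 < t" "t < 1" for t
      using derA[of t] nonneg[of t] that by auto
    show "continuous_on {0..1} A"
      using derA by (intro DERIV_continuous_on) (auto intro: has_field_derivative_at_within)
  qed simp
  then show ?thesis by (simp add: A_def F_def mult.commute)
qed

section \<open>Integrals over balls and spherical shells\<close>

lemma integral_lborel_scale:
  fixes f :: "'a::euclidean_space \<Rightarrow> real"
  assumes [measurable]: "f \<in> borel_measurable borel" and c: "c > 0"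
  shows "(LINT x|lborel. f x) = c ^ DIM('a) * (LINT x|lborel. f (c *\<^sub>R x))"
proof -
  have "(LINT x|lborel. f x) = (LINT x|density (distr lborel borel (\<lambda>x. 0 + c *\<^sub>R x)) (\<lambda>_. \<bar>c\<bar> ^ DIM('a)). f x)"
    using lborel_affine[of c "0::'a"] c by simp
  also have "\<dots> = (LINT x|lborel. c ^ DIM('a) * f (c *\<^sub>R x))"
    using c by (simp add: integral_density integral_distr)
  finally show ?thesis by simp
qed

lemma integral_ball_homogeneous:
  fixes \<Gamma> :: "'a::euclidean_space \<Rightarrow> real"
  assumes [measurable]: "\<Gamma> \<in> borel_measurable borel" and c: "c > 0"
    and hom: "\<And>x. \<Gamma> (c *\<^sub>R x) = \<Gamma> x"
  shows "(LINT x:ball 0 c|lborel. \<Gamma> x) = c ^ DIM('a) * (LINT x:ball 0 1|lborel. \<Gamma> x)"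
proof -
  have "indicator (ball 0 c) (c *\<^sub>R x) = (indicator (ball 0 1) x :: real)" for x :: 'a
    using c by (simp add: indicator_def)
  then show ?thesis
    unfolding set_lebesgue_integral_def
    by (subst integral_lborel_scale[OF _ c])
       (auto simp: hom simp del: indicator_simps intro!: borel_measurable_times borel_measurable_indicator)
qed

text \<open>A shell is a difference of balls, and dilation invariance makes the integral over a ball
  proportional to the n-th power of its radius. This links averages over shells with the integral
  over the unit ball by which \<open>Mp\<close> encodes the spherical mean.\<close>

lemma integral_shell_homogeneous:
  fixes \<Gamma> :: "'a::euclidean_space \<Rightarrow> real"
  assumes [measurable]: "\<Gamma> \<in> borel_measurable borel" and bound: "\<And>x. \<bar>\<Gamma> x\<bar> \<le> M"
    and hom: "\<And>c x. c > 0 \<Longrightarrow> \<Gamma> (c *\<^sub>R x) = \<Gamma> x" and r: "0 < r" "r \<le> c"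
  shows "set_integrable lborel (ball 0 c - ball 0 r) \<Gamma>"
    and "(LINT x:ball 0 c - ball 0 r|lborel. \<Gamma> x) = (c ^ DIM('a) - r ^ DIM('a)) * (LINT x:ball 0 1|lborel. \<Gamma> x)"
proof -
  have int: "set_integrable lborel (ball 0 t) \<Gamma>" for t
    unfolding set_integrable_def
  proof (rule integrableI_bounded_set_indicator[where B=M])
    show "emeasure lborel (ball (0::'a) t) < \<infinity>" by (rule emeasure_lborel_ball_finite)
  qed (use bound in auto)
  then show 1: "set_integrable lborel (ball 0 c - ball 0 r) \<Gamma>"
    by (rule set_integrable_subset) auto
  have un: "(ball 0 c - ball 0 r) \<union> ball 0 r = ball (0::'a) c" using r by auto
  have "(LINT x:(ball 0 c - ball 0 r) \<union> ball 0 r|lborel. \<Gamma> x) =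
      (LINT x:ball 0 c - ball 0 r|lborel. \<Gamma> x) + (LINT x:ball 0 r|lborel. \<Gamma> x)"
    by (rule set_integral_Un) (use 1 int in auto)
  then show "(LINT x:ball 0 c - ball 0 r|lborel. \<Gamma> x) = (c ^ DIM('a) - r ^ DIM('a)) * (LINT x:ball 0 1|lborel. \<Gamma> x)"
    unfolding un using integral_ball_homogeneous[OF assms(1), of c] integral_ball_homogeneous[OF assms(1), of r] r hom
    by (simp add: algebra_simps)
qed

lemma continuous_on_bump: "continuous_on UNIV bump"
  using DERIV_bump DERIV_isCont continuous_at_imp_continuous_on by blast

text \<open>Continuous weights between 0 and 1 converge to the indicator of the shell, so the
  weighted inequality passes to the limit by dominated convergence.\<close>

lemma submean_shell:
  fixes g :: "'a::euclidean_space \<Rightarrow> real" and D D' :: "'a \<Rightarrow> 'a \<Rightarrow> real"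
  assumes g: "continuous_on (ball 0 1) g"
    and D: "\<And>b. b \<in> Basis \<Longrightarrow> continuous_on (ball 0 1) (D b)"
    and D': "\<And>b. b \<in> Basis \<Longrightarrow> continuous_on (ball 0 1) (D' b)"
    and der: "\<And>b x. b \<in> Basis \<Longrightarrow> x \<in> ball 0 1 \<Longrightarrow> ((\<lambda>t. g (x + t *\<^sub>R b)) has_real_derivative D b x) (at 0)"
    and der2: "\<And>b x. b \<in> Basis \<Longrightarrow> x \<in> ball 0 1 \<Longrightarrow> ((\<lambda>t. D b (x + t *\<^sub>R b)) has_real_derivative D' b x) (at 0)"
    and lap: "\<And>x. x \<in> ball 0 1 \<Longrightarrow> 0 \<le> (\<Sum>b\<in>Basis. D' b x)"
    and r: "0 < r" "r < c" "c < 1"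
  shows "set_integrable lborel (ball 0 c - ball 0 r) g"
    and "g 0 * measure lborel (ball 0 c - ball 0 r :: 'a set) \<le> (LINT x:ball 0 c - ball 0 r|lborel. g x)"
proof -
  let ?S = "ball 0 c - ball 0 r :: 'a set"
  \<comment> \<open>The first factor removes the inner ball and the second cuts off at
    \<open>c\<close>. As \<open>bump\<close> vanishes at 0, the limit keeps the sphere of radius
    \<open>r\<close> and drops that of radius \<open>c\<close>, exactly as
    \<open>ball 0 c - ball 0 r\<close> does.\<close>
  define \<eta> where "\<eta> k s = (1 - bump (real k * (r\<^sup>2 - s))) * bump (real k * (c\<^sup>2 - s))" for k s
  have \<eta>_range: "0 \<le> \<eta> k s" "\<eta> k s \<le> 1" for k s
    using bump_range[of "real k * (r\<^sup>2 - s)"] bump_range[of "real k * (c\<^sup>2 - s)"]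
    by (auto simp: \<eta>_def mult_le_one)
  have \<eta>0: "\<eta> k s = 0" if "c\<^sup>2 \<le> s" for k s
    using that by (simp add: \<eta>_def bump_eq_0 mult_nonneg_nonpos)
  have \<eta>c: "continuous_on UNIV (\<eta> k)" for k
    unfolding \<eta>_def by (intro continuous_intros continuous_on_compose2[OF continuous_on_bump]) auto
  have sq: "(norm x)\<^sup>2 < t\<^sup>2 \<longleftrightarrow> norm x < t" if "0 < t" for x :: 'a and t
    using that power_less_imp_less_base[of "norm x" 2 t] power_strict_mono[of "norm x" t 2] by auto
  have lim: "(\<lambda>k. \<eta> k ((norm x)\<^sup>2)) \<longlonglongrightarrow> indicator ?S x" for x
  proof -
    have "(\<lambda>k. \<eta> k ((norm x)\<^sup>2)) \<longlonglongrightarrow>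
        (1 - (if r\<^sup>2 - (norm x)\<^sup>2 > 0 then 1 else 0)) * (if c\<^sup>2 - (norm x)\<^sup>2 > 0 then 1 else 0)"
      unfolding \<eta>_def by (intro tendsto_intros tendsto_bump)
    also have "(1 - (if r\<^sup>2 - (norm x)\<^sup>2 > 0 then 1 else 0)) * (if c\<^sup>2 - (norm x)\<^sup>2 > 0 then 1 else 0)
        = (indicator ?S x :: real)"
      using sq[of r x] sq[of c x] r by (simp add: indicator_def)
    finally show ?thesis .
  qed
  have \<eta>_supp: "\<eta> k ((norm x)\<^sup>2) = 0" if "x \<notin> cball 0 c" for k and x :: 'a
    using that r by (intro \<eta>0 power_mono) auto
  have int: "integrable lborel (\<lambda>x. indicator (cball 0 c) x *\<^sub>R w x)"
    if "continuous_on (ball 0 1) w" for w :: "'a \<Rightarrow> real"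
    using that r by (intro borel_integrable_compact) (auto intro: continuous_on_subset)
  have conv: "(\<lambda>k. LINT x|lborel. \<eta> k ((norm x)\<^sup>2) * w x) \<longlonglongrightarrow> (LINT x:?S|lborel. w x)"
    if w: "continuous_on (ball 0 1) w" for w :: "'a \<Rightarrow> real"
  proof -
    have eq: "\<eta> k ((norm x)\<^sup>2) * w x = \<eta> k ((norm x)\<^sup>2) * (indicator (cball 0 c) x *\<^sub>R w x)" for k x
      using \<eta>_supp[of x k] by (auto simp: indicator_def)
    have eq': "indicator ?S x *\<^sub>R w x = indicator ?S x * (indicator (cball 0 c) x *\<^sub>R w x)" for x
      by (auto simp: indicator_def)
    have meas: "(\<lambda>x. indicator (cball 0 c) x *\<^sub>R w x) \<in> borel_measurable lborel"
      using int[OF w] by (rule borel_measurable_integrable)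
    have \<eta>m: "(\<lambda>x::'a. \<eta> k ((norm x)\<^sup>2)) \<in> borel_measurable lborel" for k
      using continuous_on_compose2[OF \<eta>c, of UNIV "\<lambda>x::'a. (norm x)\<^sup>2" k]
      by (auto intro!: borel_measurable_continuous_onI continuous_intros)
    show ?thesis
      unfolding set_lebesgue_integral_def eq eq'
    proof (rule integral_dominated_convergence[where w="\<lambda>x. norm (indicator (cball 0 c) x *\<^sub>R w x)"])
      show "AE x in lborel. (\<lambda>k. \<eta> k ((norm x)\<^sup>2) * (indicator (cball 0 c) x *\<^sub>R w x))
          \<longlonglongrightarrow> indicator ?S x * (indicator (cball 0 c) x *\<^sub>R w x)"
        by (intro AE_I2 tendsto_intros lim)
      show "AE x in lborel. norm (\<eta> k ((norm x)\<^sup>2) * (indicator (cball 0 c) x *\<^sub>R w x))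
          \<le> norm (indicator (cball 0 c) x *\<^sub>R w x)" for k
        using \<eta>_range by (intro AE_I2) (simp add: abs_mult mult_left_le_one_le)
      show "integrable lborel (\<lambda>x. norm (indicator (cball 0 c) x *\<^sub>R w x))"
        by (intro integrable_norm int w)
      show "(\<lambda>x. indicator ?S x * (indicator (cball 0 c) x *\<^sub>R w x)) \<in> borel_measurable lborel"
        by (intro borel_measurable_times borel_measurable_indicator meas) auto
      show "(\<lambda>x. \<eta> k ((norm x)\<^sup>2) * (indicator (cball 0 c) x *\<^sub>R w x)) \<in> borel_measurable lborel" for k
        by (intro borel_measurable_times \<eta>m meas)
    qed
  qed
  have "set_integrable lborel (cball 0 c) g"
    unfolding set_integrable_def by (rule int[OF g])
  then show "set_integrable lborel ?S g"
    by (rule set_integrable_subset) auto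
  \<comment> \<open>The same limit with the constant function 1 produces the volume of the
    shell.\<close>
  have "(\<lambda>k. g 0 * (LINT x|lborel. \<eta> k ((norm (x::'a))\<^sup>2) * 1)) \<longlonglongrightarrow> g 0 * (LINT x:?S|lborel. 1)"
    by (intro tendsto_intros conv continuous_on_const)
  moreover have "(LINT x:?S|lborel. 1::real) = measure lborel ?S"
    by (simp add: set_lebesgue_integral_def)
  moreover have "g 0 * (LINT x|lborel. \<eta> k ((norm (x::'a))\<^sup>2) * 1) \<le> (LINT x|lborel. \<eta> k ((norm x)\<^sup>2) * g x)" for k
    using weighted_submean[OF g D D' der der2 lap \<eta>c[of k] \<eta>_range(1)[of k] \<eta>0[of _ k]] r by simp
  ultimately show "g 0 * measure lborel ?S \<le> (LINT x:?S|lborel. g x)"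
    using conv[OF g] by (intro LIMSEQ_le) auto
qed

section \<open>Radial projection onto a sphere\<close>

lemma norm_radial_projection_le: "0 \<le> r \<Longrightarrow> norm (r *\<^sub>R (x /\<^sub>R norm x)) \<le> r"
  \<comment> \<open>The norm is exactly \<open>r\<close> away from the origin, while the origin is
    sent to 0 because \<open>inverse 0 = 0\<close>.\<close>
  by (cases "x = 0") (simp_all add: field_simps)

text \<open>Times the indicator of the open ball, \<open>g\<close> is Borel on the whole space; the
  projection only takes values where the indicator is 1.\<close>

lemma borel_measurable_radial_projection:
  fixes g :: "'a::euclidean_space \<Rightarrow> 'b::euclidean_space"
  assumes "continuous_on (ball 0 1) g" "0 \<le> r" "r < 1"
  shows "(\<lambda>x. g (r *\<^sub>R (x /\<^sub>R norm x))) \<in> borel_measurable borel"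
proof -
  have "(\<lambda>x. indicator (ball 0 1) x *\<^sub>R g x) \<in> borel_measurable borel"
    using assms by (intro borel_measurable_continuous_on_indicator) auto
  then have "(\<lambda>x. indicator (ball 0 1) (r *\<^sub>R (x /\<^sub>R norm x)) *\<^sub>R g (r *\<^sub>R (x /\<^sub>R norm x))) \<in> borel_measurable borel"
    by (rule measurable_compose_rev) measurable
  moreover have "r *\<^sub>R (x /\<^sub>R norm x) \<in> ball 0 1" for x :: 'a
    using norm_radial_projection_le[OF assms(2), of x] assms(3) by (simp only: mem_ball_0)
  then have "(\<lambda>x. indicator (ball 0 1) (r *\<^sub>R (x /\<^sub>R norm x)) *\<^sub>R g (r *\<^sub>R (x /\<^sub>R norm x))) = (\<lambda>x. g (r *\<^sub>R (x /\<^sub>R norm x)))"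
    by (simp add: indicator_def)
  ultimately show ?thesis by simp
qed

lemma bounded_radial_projection:
  fixes g :: "'a::euclidean_space \<Rightarrow> 'b::euclidean_space"
  assumes "continuous_on (ball 0 1) g" "0 \<le> r" "r < 1"
  obtains M where "\<And>x. norm (g (r *\<^sub>R (x /\<^sub>R norm x))) \<le> M"
proof -
  have "bounded (g ` cball 0 r)"
    using assms by (intro compact_imp_bounded compact_continuous_image) (auto intro: continuous_on_subset)
  then obtain M where "\<forall>y\<in>g ` cball 0 r. norm y \<le> M" unfolding bounded_iff by blast
  moreover have "r *\<^sub>R (x /\<^sub>R norm x) \<in> cball 0 r" for x :: 'a
    using norm_radial_projection_le[OF assms(2), of x] by (simp only: mem_cball_0)
  ultimately have "norm (g (r *\<^sub>R (x /\<^sub>R norm x))) \<le> M" for x by blast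
  then show ?thesis by (rule that)
qed

text \<open>On a thin shell \<open>{r \<le> |x| < c}\<close> the function is uniformly close to its radial
  projection from the sphere of radius \<open>r\<close>.\<close>

lemma submean_sphere:
  fixes g :: "'a::euclidean_space \<Rightarrow> real" and D D' :: "'a \<Rightarrow> 'a \<Rightarrow> real"
  assumes g: "continuous_on (ball 0 1) g"
    and D: "\<And>b. b \<in> Basis \<Longrightarrow> continuous_on (ball 0 1) (D b)"
    and D': "\<And>b. b \<in> Basis \<Longrightarrow> continuous_on (ball 0 1) (D' b)"
    and der: "\<And>b x. b \<in> Basis \<Longrightarrow> x \<in> ball 0 1 \<Longrightarrow> ((\<lambda>t. g (x + t *\<^sub>R b)) has_real_derivative D b x) (at 0)"
    and der2: "\<And>b x. b \<in> Basis \<Longrightarrow> x \<in> ball 0 1 \<Longrightarrow> ((\<lambda>t. D b (x + t *\<^sub>R b)) has_real_derivative D' b x) (at 0)"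
    and lap: "\<And>x. x \<in> ball 0 1 \<Longrightarrow> 0 \<le> (\<Sum>b\<in>Basis. D' b x)"
    and r: "0 < r" "r < 1"
  shows "g 0 * measure lborel (ball (0::'a) 1) \<le> (LINT x:ball 0 1|lborel. g (r *\<^sub>R (x /\<^sub>R norm x)))"
proof -
  define \<Gamma> where "\<Gamma> x = g (r *\<^sub>R (x /\<^sub>R norm x))" for x
  have \<Gamma>m: "\<Gamma> \<in> borel_measurable borel"
    unfolding \<Gamma>_def using g r by (intro borel_measurable_radial_projection) auto
  obtain M where "\<And>x. norm (\<Gamma> x) \<le> M"
    unfolding \<Gamma>_def using bounded_radial_projection[OF g, of r] r by auto
  then have \<Gamma>b: "\<And>x. \<bar>\<Gamma> x\<bar> \<le> M" by simp
  have \<Gamma>h: "\<Gamma> (c *\<^sub>R x) = \<Gamma> x" if "c > 0" for c x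
  proof -
    have "(c *\<^sub>R x) /\<^sub>R norm (c *\<^sub>R x) = x /\<^sub>R norm x"
      using that by simp
    then show ?thesis unfolding \<Gamma>_def by (rule arg_cong)
  qed
  let ?B = "measure lborel (ball (0::'a) 1)"
  have "(g 0 - \<tau>) * ?B \<le> (LINT x:ball 0 1|lborel. \<Gamma> x)" if \<tau>: "\<tau> > 0" for \<tau>
  proof -
    \<comment> \<open>Any radius strictly between \<open>r\<close> and 1 serves: it gives a compact
      ball on which \<open>g\<close> is uniformly continuous and which contains the thin
      shell.\<close>
    define R where "R = (1 + r) / 2"
    have R: "r < R" "R < 1" using r by (auto simp: R_def)
    have "uniformly_continuous_on (cball 0 R) g"
      using R by (intro compact_uniformly_continuous continuous_on_subset[OF g]) auto
    then obtain \<delta> where \<delta>: "\<delta> > 0"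
      "\<And>x y. x \<in> cball 0 R \<Longrightarrow> y \<in> cball 0 R \<Longrightarrow> dist y x < \<delta> \<Longrightarrow> dist (g y) (g x) < \<tau>"
      unfolding uniformly_continuous_on_def using \<tau> by metis
    define c where "c = min R (r + \<delta>)"
    have c: "r < c" "c < 1" "c \<le> R" "c \<le> r + \<delta>" using R \<delta>(1) by (auto simp: c_def)
    let ?S = "ball 0 c - ball 0 r :: 'a set"
    \<comment> \<open>A point of the shell lies at distance norm x - r < c - r \<le> \<delta> from
      its projection.\<close>
    have near: "g x - \<tau> \<le> \<Gamma> x" if x: "x \<in> ?S" for x
    proof -
      have nx: "r \<le> norm x" "norm x < c" using x by auto
      have "dist x (r *\<^sub>R (x /\<^sub>R norm x)) = norm ((norm x - r) *\<^sub>R (x /\<^sub>R norm x))"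
        using nx r by (cases "x = 0") (auto simp: dist_norm algebra_simps intro!: arg_cong[where f=norm])
      also have "\<dots> = norm x - r" using nx r by (cases "x = 0") (simp_all add: field_simps)
      also have "\<dots> < \<delta>" using nx c by simp
      finally have "dist (g x) (g (r *\<^sub>R (x /\<^sub>R norm x))) < \<tau>"
        using nx c R norm_radial_projection_le[of r x] r(1)
        by (intro \<delta>(2)) (simp_all only: mem_cball_0, linarith+)
      then show ?thesis by (simp add: \<Gamma>_def dist_real_def)
    qed
    have rc: "r \<le> c" using c by simp
    note shell = submean_shell[OF g D D' der der2 lap r(1) c(1,2)]
    note hom\<Gamma> = integral_shell_homogeneous[OF \<Gamma>m \<Gamma>b \<Gamma>h r(1) rc]
    have const: "set_integrable lborel ?S (\<lambda>x. k::real)"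
      and "(LINT x:?S|lborel. 1::real) = (c ^ DIM('a) - r ^ DIM('a)) * (LINT x:ball (0::'a) 1|lborel. 1)" for k
      using integral_shell_homogeneous(1)[of "\<lambda>x::'a. k" "\<bar>k\<bar>", OF _ _ _ r(1) rc]
        integral_shell_homogeneous(2)[of "\<lambda>x::'a. 1::real" 1, OF _ _ _ r(1) rc] by auto
    then have vol: "measure lborel ?S = (c ^ DIM('a) - r ^ DIM('a)) * ?B"
      by (simp add: set_lebesgue_integral_def)
    \<comment> \<open>The volume of the shell and the integral of the projected function carry the
      same positive factor c^n - r^n. It cancels, so only \<tau> remains to be sent to 0.\<close>
    have "(c ^ DIM('a) - r ^ DIM('a)) * ((g 0 - \<tau>) * ?B) = g 0 * measure lborel ?S - \<tau> * measure lborel ?S"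
      by (simp add: vol algebra_simps)
    also have "\<dots> \<le> (LINT x:?S|lborel. g x) - (LINT x:?S|lborel. \<tau>)"
      using shell(2) by (simp add: set_lebesgue_integral_def mult.commute)
    also have "\<dots> = (LINT x:?S|lborel. g x - \<tau>)"
      using shell(1) const by (simp add: set_integral_diff)
    also have "\<dots> \<le> (LINT x:?S|lborel. \<Gamma> x)"
      using shell(1) const hom\<Gamma>(1) near by (intro set_integral_mono set_integral_diff) auto
    also have "\<dots> = (c ^ DIM('a) - r ^ DIM('a)) * (LINT x:ball 0 1|lborel. \<Gamma> x)"
      by (rule hom\<Gamma>(2))
    finally show ?thesis
      using c r power_strict_mono[of r c "DIM('a)"] by (simp add: mult_le_cancel_left)
  qed
  then have "g 0 * ?B \<le> (LINT x:ball 0 1|lborel. \<Gamma> x) + \<tau> * ?B" if "\<tau> > 0" for \<tau>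
    using that by (simp add: algebra_simps)
  moreover have "?B > 0"
    using content_ball_pos[of 1 "0::'a"] by simp
  ultimately have "g 0 * ?B \<le> (LINT x:ball 0 1|lborel. \<Gamma> x) + \<epsilon>" if "\<epsilon> > 0" for \<epsilon>
    using that by (metis divide_pos_pos nonzero_eq_divide_eq less_irrefl)
  then show ?thesis
    unfolding \<Gamma>_def by (rule field_le_epsilon)
qed

section \<open>Pointwise consequences of quasiregularity\<close>

text \<open>The weak and the classical derivative satisfy the same integration by parts identity, so
  their difference integrates to zero against every test function; the fundamental lemma applies on
  each smaller ball.\<close>

lemma AE_weak_derivative_eq_pd:
  fixes f :: "'a::euclidean_space \<Rightarrow> 'b::euclidean_space"
  assumes W: "W1p_loc p (ball 0 1) f g" and i: "i \<in> Basis" and j: "j \<in> Basis"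
    and C1: "C1_on (ball 0 1) (\<lambda>x. f x \<bullet> i)"
  shows "AE x in lebesgue. x \<in> ball 0 1 \<longrightarrow> g x i j = pd j (\<lambda>x. f x \<bullet> i) x"
proof -
  let ?u = "\<lambda>x. f x \<bullet> i"
  have pdc: "continuous_on (ball 0 1) (pd j ?u)"
    using C1 j by (rule C1_on_imp_continuous_on_pd)
  \<comment> \<open>\<open>W1p_loc\<close> provides integrability on compact subsets, hence the
    radii s < 1. Countably many of these balls exhaust the unit ball.\<close>
  have "AE x in lebesgue. x \<in> ball 0 s \<longrightarrow> g x i j - pd j ?u x = 0" if s: "s < 1" for s
  proof (rule AE_eq_0_if_test_integrals_eq_0)
    have "set_integrable lborel (cball 0 s) (pd j ?u)"
      unfolding set_integrable_def
      using s by (intro borel_integrable_compact continuous_on_subset[OF pdc]) auto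
    then have "set_integrable lebesgue (cball 0 s) (pd j ?u)"
      unfolding set_integrable_def by (subst integrable_completion) auto
    moreover have "set_integrable lebesgue (cball 0 s) (\<lambda>x. g x i j)"
      using W i j s unfolding W1p_loc_def by (auto simp: subset_eq)
    ultimately have "set_integrable lebesgue (cball 0 s) (\<lambda>x. g x i j - pd j ?u x)"
      by (intro set_integral_diff)
    then show "set_integrable lebesgue (ball 0 s) (\<lambda>x. g x i j - pd j ?u x)"
      by (rule set_integrable_subset) auto
  next
    fix \<phi> assume \<phi>: "C1_on UNIV \<phi>" "\<And>x::'a. x \<notin> ball 0 s \<Longrightarrow> \<phi> x = 0"
    have "closure {x. \<phi> x \<noteq> 0} \<subseteq> cball 0 s"
      using \<phi>(2) by (intro closure_minimal) (force simp: not_less)+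
    moreover from this have "compact (closure {x. \<phi> x \<noteq> 0})"
      by (meson bounded_cball bounded_subset closed_closure compact_eq_bounded_closed)
    ultimately have test: "test_fn (ball 0 1) \<phi>"
      using \<phi>(1) s by (fastforce simp: test_fn_def)
    have int: "set_integrable lebesgue (ball 0 1) (\<lambda>x. g x i j * \<phi> x)"
      and eq: "(LINT x:ball 0 1|lebesgue. ?u x * pd j \<phi> x) = - (LINT x:ball 0 1|lebesgue. g x i j * \<phi> x)"
      using W test i j unfolding W1p_loc_def by blast+
    note ibp = integration_by_parts_test_fn[OF open_ball j test C1_on_imp_continuous_on[OF C1] pdc C1_on_DERIV[OF C1 j]]
    \<comment> \<open>The weak identity is stated over \<open>lebesgue\<close> and the classical one
      over \<open>lborel\<close>; for Borel integrands the two integrals agree.\<close>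
    have lb: "set_integrable lebesgue (ball 0 1) w \<and> (LINT x:ball 0 1|lebesgue. w x) = (LINT x:ball 0 1|lborel. w x)"
      if "set_integrable lborel (ball 0 1) w" for w :: "'a \<Rightarrow> real"
      using that borel_measurable_integrable[OF that[unfolded set_integrable_def]]
      unfolding set_integrable_def set_lebesgue_integral_def
      by (simp add: integrable_completion integral_completion)
    have "(LINT x:ball 0 1|lebesgue. pd j ?u x * \<phi> x) = (LINT x:ball 0 1|lebesgue. g x i j * \<phi> x)"
      using eq ibp(3) lb[OF ibp(1)] lb[OF ibp(2)] by simp
    then have "(LINT x:ball 0 1|lebesgue. g x i j * \<phi> x - pd j ?u x * \<phi> x) = 0"
      using int lb[OF ibp(2)] by (subst set_integral_diff) auto
    also have "(LINT x:ball 0 1|lebesgue. g x i j * \<phi> x - pd j ?u x * \<phi> x)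
        = (LINT x:ball 0 s|lebesgue. (g x i j - pd j ?u x) * \<phi> x)"
      unfolding set_lebesgue_integral_def using \<phi>(2) s
      by (intro Bochner_Integration.integral_cong) (auto simp: indicator_def algebra_simps)
    finally show "(LINT x:ball 0 s|lebesgue. (g x i j - pd j ?u x) * \<phi> x) = 0" .
  qed
  then have "AE x in lebesgue. x \<in> ball 0 (1 - 1 / Suc k) \<longrightarrow> g x i j - pd j ?u x = 0" for k
    by simp
  then have "AE x in lebesgue. \<forall>k. x \<in> ball 0 (1 - 1 / Suc k) \<longrightarrow> g x i j - pd j ?u x = 0"
    unfolding AE_all_countable by blast
  then show ?thesis
  proof eventually_elim
    case (elim x)
    show ?case
    proof
      assume "x \<in> ball 0 1"
      then obtain k where "1 / Suc k < 1 - norm x"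
        using nat_approx_posE[of "1 - norm x"] by auto
      then have "x \<in> ball 0 (1 - 1 / Suc k)" by simp
      then show "g x i j = pd j ?u x" using elim by force
    qed
  qed
qed

lemma linear_Dlin: "linear (Dlin g x)"
  unfolding Dlin_def
  by (intro linearI) (simp_all add: inner_simps distrib_left sum.distrib scaleR_add_left
      scaleR_sum_right sum_distrib_left mult_ac)

text \<open>The supremum in \<open>opnorm\<close> is an upper bound because a linear map in finite
  dimension is bounded on the unit sphere.\<close>

lemma norm_le_opnorm:
  assumes "linear L" "norm h = 1"
  shows "norm (L h) \<le> opnorm L"
  unfolding opnorm_def
proof (rule cSUP_upper)
  have "bounded_linear L" using assms(1) by (simp add: linear_conv_bounded_linear)
  then obtain B where B: "\<And>h. norm (L h) \<le> norm h * B"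
    using bounded_linear.bounded by blast
  show "bdd_above ((\<lambda>h. norm (L h)) ` sphere 0 1)"
  proof (rule bdd_aboveI2)
    show "norm (L h) \<le> B" if "h \<in> sphere 0 1" for h
      using B[of h] that by simp
  qed
qed (use assms in simp)

lemma ellnorm_le_norm:
  assumes "norm k = 1"
  shows "ellnorm L \<le> norm (L k)"
  unfolding ellnorm_def
  by (rule cINF_lower) (use assms in \<open>auto intro!: bdd_belowI2[where m=0]\<close>)

text \<open>For fixed \<open>h\<close> and \<open>k\<close> the set where the bound fails is open,
  by continuity of the partial derivatives, and null, by the almost everywhere hypothesis. A
  nonempty open set is not null.\<close>

lemma quasiregular_imp_classical_dilatation:
  fixes f :: "'a::euclidean_space \<Rightarrow> 'a"
  assumes qr: "quasiregular K (ball 0 1) f"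
    and C1: "\<And>i. i \<in> Basis \<Longrightarrow> C1_on (ball 0 1) (\<lambda>x. f x \<bullet> i)"
    and x: "x \<in> ball 0 1" and h: "norm h = 1" and k: "norm k = 1"
  defines "A \<equiv> Dlin (\<lambda>x i j. pd j (\<lambda>x. f x \<bullet> i) x)"
  shows "norm (A x h) \<le> K * norm (A x k)"
proof (rule ccontr)
  assume contra: "\<not> norm (A x h) \<le> K * norm (A x k)"
  obtain g where W: "W1p_loc (real DIM('a)) (ball 0 1) f g"
    and dil: "AE x in lebesgue. x \<in> ball 0 1 \<longrightarrow> opnorm (Dlin g x) \<le> K * ellnorm (Dlin g x)"
    and K: "K \<ge> 1"
    using qr unfolding quasiregular_def by blast
  have "AE x in lebesgue. \<forall>i\<in>Basis. \<forall>j\<in>Basis. x \<in> ball 0 1 \<longrightarrow> g x i j = pd j (\<lambda>x. f x \<bullet> i) x"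
    using AE_weak_derivative_eq_pd[OF W _ _ C1] by (intro AE_ball_countable' countable_finite finite_Basis) auto
  then have ae: "AE y in lebesgue. y \<in> ball 0 1 \<longrightarrow> norm (A y h) \<le> K * norm (A y k)"
    using dil
  proof eventually_elim
    case (elim y)
    show ?case
    proof
      assume y: "y \<in> ball 0 1"
      have "A y = Dlin g y"
        using elim(1) y unfolding A_def Dlin_def by (intro ext sum.cong refl) simp
      then have "norm (A y h) \<le> opnorm (Dlin g y)" "ellnorm (Dlin g y) \<le> norm (A y k)"
        using norm_le_opnorm[OF linear_Dlin h] ellnorm_le_norm[OF k] by metis+
      moreover have "opnorm (Dlin g y) \<le> K * ellnorm (Dlin g y)"
        using elim(2) y by blast
      ultimately show "norm (A y h) \<le> K * norm (A y k)"
        using K by (meson mult_left_mono order_trans zero_le_one)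
    qed
  qed
  define N where "N = {y \<in> ball 0 1. K * norm (A y k) < norm (A y h)}"
  have cA: "continuous_on (ball 0 1) (\<lambda>y. A y v)" for v
    unfolding A_def Dlin_def
    by (intro continuous_intros C1_on_imp_continuous_on_pd[OF C1])
  have "open N"
  proof -
    have "continuous_on (ball 0 1) (\<lambda>y. norm (A y h) - K * norm (A y k))"
      by (intro continuous_intros cA)
    then have "open (ball 0 1 \<inter> (\<lambda>y. norm (A y h) - K * norm (A y k)) -` {0<..})"
      by (intro continuous_open_preimage) auto
    also have "ball 0 1 \<inter> (\<lambda>y. norm (A y h) - K * norm (A y k)) -` {0<..} = N"
      by (auto simp: N_def)
    finally show ?thesis .
  qed
  moreover have "N \<noteq> {}" using x contra by (auto simp: N_def)
  moreover have "negligible N"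
  proof -
    have "AE y in lebesgue. y \<notin> N"
      using ae by eventually_elim (auto simp: N_def)
    then have "N \<in> null_sets lebesgue"
      using \<open>open N\<close> by (subst (asm) AE_iff_null_sets[symmetric]) auto
    then show ?thesis by (simp add: negligible_iff_null_sets)
  qed
  ultimately show False using open_not_negligible by blast
qed

text \<open>The gradients of the components of f are the images of the basis vectors under the
  adjoint of Df, whose dilatation is also at most K. Hence each of the other n - 1 gradients is at
  most K times the one for \<open>e\<close>, and every gradient times \<open>norm v\<close> is at
  most K times the norm of the adjoint applied to \<open>v\<close>; summing squares gives both
  bounds.\<close>

lemma gradient_bounds:
  fixes f :: "'a::euclidean_space \<Rightarrow> 'a"
  assumes qr: "quasiregular K (ball 0 1) f"
    and C1: "\<And>i. i \<in> Basis \<Longrightarrow> C1_on (ball 0 1) (\<lambda>x. f x \<bullet> i)"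
    and x: "x \<in> ball 0 1" and e: "e \<in> Basis"
  defines "G \<equiv> \<lambda>i j. pd j (\<lambda>x. f x \<bullet> i) x"
  shows "(\<Sum>i\<in>Basis. \<Sum>j\<in>Basis. (G i j)\<^sup>2) \<le> (1 + (real DIM('a) - 1) * K\<^sup>2) * (\<Sum>j\<in>Basis. (G e j)\<^sup>2)"
    and "(\<Sum>i\<in>Basis. \<Sum>j\<in>Basis. (G i j)\<^sup>2) * (norm v)\<^sup>2
        \<le> real DIM('a) * K\<^sup>2 * (\<Sum>j\<in>Basis. (\<Sum>i\<in>Basis. (v \<bullet> i) * G i j)\<^sup>2)"
proof -
  have K: "K \<ge> 1" using qr by (simp add: quasiregular_def)
  define A where "A = Dlin (\<lambda>x i j. pd j (\<lambda>x. f x \<bullet> i) x) x"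
  have lin: "linear A" unfolding A_def by (rule linear_Dlin)
  have adj: "norm (adjoint A u) \<le> K * norm (adjoint A w)" if "norm u = 1" "norm w = 1" for u w
    using quasiregular_imp_classical_dilatation[OF qr C1 x] K that
    by (intro adjoint_quasiconformal[OF lin]) (auto simp: A_def)
  have coord: "adjoint A u \<bullet> j = (\<Sum>i\<in>Basis. (u \<bullet> i) * G i j)" if "j \<in> Basis" for u j
  proof -
    have "adjoint A u \<bullet> j = u \<bullet> A j" by (rule adjoint_clauses(2)[OF lin])
    also have "A j = (\<Sum>i\<in>Basis. G i j *\<^sub>R i)"
      unfolding A_def Dlin_def G_def using that
      by (intro sum.cong refl) (simp add: inner_Basis if_distrib cong: if_cong)
    finally show ?thesis by (simp add: inner_sum_right mult.commute)
  qed
  have sq: "(norm (adjoint A u))\<^sup>2 = (\<Sum>j\<in>Basis. (\<Sum>i\<in>Basis. (u \<bullet> i) * G i j)\<^sup>2)" for u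
  proof -
    have "(norm (adjoint A u))\<^sup>2 = (\<Sum>j\<in>Basis. (adjoint A u \<bullet> j) * (adjoint A u \<bullet> j))"
      unfolding power2_norm_eq_inner by (rule euclidean_inner)
    then show ?thesis by (simp add: coord power2_eq_square)
  qed
  have row: "(norm (adjoint A i))\<^sup>2 = (\<Sum>j\<in>Basis. (G i j)\<^sup>2)" if "i \<in> Basis" for i
    unfolding sq using that by (intro sum.cong refl) (simp add: inner_Basis if_distribR if_distrib[of "\<lambda>c. c * _"] cong: if_cong)
  have S: "(\<Sum>i\<in>Basis. \<Sum>j\<in>Basis. (G i j)\<^sup>2) = (\<Sum>i\<in>Basis. (norm (adjoint A i))\<^sup>2)"
    by (simp add: row)
  have "(\<Sum>i\<in>Basis. (norm (adjoint A i))\<^sup>2) = (norm (adjoint A e))\<^sup>2 + (\<Sum>i\<in>Basis - {e}. (norm (adjoint A i))\<^sup>2)"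
    using e by (simp add: sum.remove)
  also have "(\<Sum>i\<in>Basis - {e}. (norm (adjoint A i))\<^sup>2) \<le> real (card (Basis - {e})) * (K * norm (adjoint A e))\<^sup>2"
    using e by (intro sum_bounded_above power_mono adj) auto
  also have "real (card (Basis - {e})) = real DIM('a) - 1"
    using e DIM_positive[where 'a='a] by (simp add: card_Diff_singleton of_nat_diff)
  finally show "(\<Sum>i\<in>Basis. \<Sum>j\<in>Basis. (G i j)\<^sup>2) \<le> (1 + (real DIM('a) - 1) * K\<^sup>2) * (\<Sum>j\<in>Basis. (G e j)\<^sup>2)"
    unfolding S row[OF e, symmetric] by (simp add: algebra_simps power_mult_distrib)
  have "(norm (adjoint A i))\<^sup>2 * (norm v)\<^sup>2 \<le> K\<^sup>2 * (norm (adjoint A v))\<^sup>2" if i: "i \<in> Basis" for i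
  proof (cases "v = 0")
    case False
    have "norm (adjoint A i) \<le> K * norm (adjoint A (v /\<^sub>R norm v))"
      using i False by (intro adj) auto
    then have "norm (adjoint A i) * norm v \<le> K * norm (adjoint A v)"
      using False by (simp add: linear_scale[OF adjoint_linear[OF lin]] field_simps)
    then have "(norm (adjoint A i) * norm v)\<^sup>2 \<le> (K * norm (adjoint A v))\<^sup>2"
      by (intro power_mono) auto
    then show ?thesis by (simp add: power_mult_distrib)
  qed simp
  then have "(\<Sum>i\<in>Basis. (norm (adjoint A i))\<^sup>2 * (norm v)\<^sup>2) \<le> real DIM('a) * (K\<^sup>2 * (norm (adjoint A v))\<^sup>2)"
    by (intro sum_bounded_above)
  then show "(\<Sum>i\<in>Basis. \<Sum>j\<in>Basis. (G i j)\<^sup>2) * (norm v)\<^sup>2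
        \<le> real DIM('a) * K\<^sup>2 * (\<Sum>j\<in>Basis. (\<Sum>i\<in>Basis. (v \<bullet> i) * G i j)\<^sup>2)"
    unfolding S sq by (simp add: sum_distrib_right mult.assoc)
qed

text \<open>Both regularizations carry a positive multiple of \<open>\<epsilon>\<close>, and the one on the right
  dominates because \<open>(1 + (n - 1) K\<^sup>2) / (n K\<^sup>2) \<le> C\<close>, so that no error term is left for \<open>\<epsilon> > 0\<close>.\<close>

lemma regularized_laplacian_le:
  fixes p K n \<epsilon> a b S T Q :: real
  assumes p: "1 < p" "p \<le> 2" and K: "K \<ge> 1" and n: "n \<ge> 1" and \<epsilon>: "\<epsilon> > 0"
    and b: "a\<^sup>2 \<le> b" and T: "T \<ge> 0" and S: "S \<ge> 0"
    and ST: "S \<le> (1 + (n - 1) * K\<^sup>2) * T" and SQ: "S * b \<le> n * K\<^sup>2 * Q"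
  shows "(\<epsilon> + b) powr (p/2 - 2) * ((\<epsilon> + b) * S + (p - 2) * Q)
    \<le> ((1 + (n - 1) * K\<^sup>2) * (1 + (p - 2) / (n * K\<^sup>2)) / (p - 1))
        * ((\<epsilon> + a\<^sup>2) powr (p/2 - 2) * ((\<epsilon> + a\<^sup>2) * T + (p - 2) * (a\<^sup>2 * T)))"
proof -
  \<comment> \<open>In the application a and b are f_1 and |f|^2, T is the squared gradient of f_1,
    S the sum of all squared partial derivatives and Q = |Df^T f|^2. With \<kappa> below,
    \<open>SQ\<close> says Q \<ge> \<kappa> b S.\<close>
  define m where "m = 1 + (n - 1) * K\<^sup>2"
  define \<kappa> where "\<kappa> = 1 / (n * K\<^sup>2)"
  define w where "w = \<epsilon> + b"
  define v where "v = \<epsilon> + a\<^sup>2"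
  define C where "C = m * (1 + (p - 2) * \<kappa>) / (p - 1)"
  have K2: "K\<^sup>2 \<ge> 1" using K by simp
  have nK: "n * K\<^sup>2 \<ge> 1" using n K2 mult_mono[of 1 n 1 "K\<^sup>2"] by simp
  have \<kappa>: "0 < \<kappa>" "\<kappa> \<le> 1" using nK by (simp_all add: \<kappa>_def divide_le_eq_1)
  have m: "m \<ge> 1" using n K by (simp add: m_def)
  have v: "v > 0" "v \<le> w" and w: "w > 0"
    unfolding v_def w_def using \<epsilon> b zero_le_power2[of a] by linarith+
  have c1: "1 - (2 - p) * \<kappa> \<ge> p - 1"
    using mult_left_le[of \<kappa> "2 - p"] \<kappa> p by simp
  have Cp: "C * (p - 1) = m * (1 - (2 - p) * \<kappa>)"
  proof -
    have "C * (p - 1) = m * (1 + (p - 2) * \<kappa>)" using p by (simp add: C_def)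
    then show ?thesis by (simp add: algebra_simps)
  qed
  \<comment> \<open>After cancelling \<open>m\<close> this is just \<kappa> \<le> 1. It yields m
    \<kappa> \<le> C, which later absorbs the term in \<epsilon>.\<close>
  have "m * \<kappa> * (p - 1) \<le> m * (1 - (2 - p) * \<kappa>)"
    using m \<kappa> p by (simp add: algebra_simps)
  then have mC: "m * \<kappa> \<le> C"
    using p Cp by (metis diff_gt_0_iff_gt mult_le_cancel_right_pos)
  have wp: "w powr (p/2 - 1) = w powr (p/2 - 2) * w" and vp: "v powr (p/2 - 1) = v powr (p/2 - 2) * v"
    using v w by (simp_all add: powr_mult_base powr_diff power2_eq_square field_simps)
  have anti: "w powr (p/2 - 1) \<le> v powr (p/2 - 1)" "w powr (p/2 - 2) \<le> v powr (p/2 - 2)"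
    using v p by (auto intro!: powr_mono2')
  have "S * b * \<kappa> \<le> Q"
    using SQ nK by (simp add: \<kappa>_def field_simps)
  \<comment> \<open>Since p \<le> 2, the lower bound for \<open>Q\<close> becomes an upper bound;
    substituting b = w - \<epsilon> then isolates the term in \<epsilon>.\<close>
  then have "(p - 2) * Q \<le> (p - 2) * (S * b * \<kappa>)"
    using p by (intro mult_left_mono_neg) auto
  then have "w * S + (p - 2) * Q \<le> S * (w * (1 - (2 - p) * \<kappa>) + (2 - p) * \<kappa> * \<epsilon>)"
    by (simp add: w_def algebra_simps)
  then have "w powr (p/2 - 2) * (w * S + (p - 2) * Q)
      \<le> w powr (p/2 - 2) * (S * (w * (1 - (2 - p) * \<kappa>) + (2 - p) * \<kappa> * \<epsilon>))"
    by (intro mult_left_mono) auto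
  also have "\<dots> = S * ((1 - (2 - p) * \<kappa>) * w powr (p/2 - 1) + (2 - p) * \<kappa> * \<epsilon> * w powr (p/2 - 2))"
    by (simp add: wp algebra_simps)
  \<comment> \<open>Both exponents are nonpositive, so replacing \<open>w\<close> by the smaller
    \<open>v\<close> increases the powers; all coefficients are nonnegative.\<close>
  also have "\<dots> \<le> (m * T) * ((1 - (2 - p) * \<kappa>) * v powr (p/2 - 1) + (2 - p) * \<kappa> * \<epsilon> * v powr (p/2 - 2))"
    using ST S anti c1 p \<kappa> \<epsilon> m T
    by (intro mult_mono add_mono mult_left_mono) (auto simp: m_def intro!: add_nonneg_nonneg mult_nonneg_nonneg)
  also have "\<dots> = T * (C * (p - 1) * v powr (p/2 - 1) + (m * \<kappa>) * ((2 - p) * \<epsilon> * v powr (p/2 - 2)))"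
    unfolding Cp by (simp add: algebra_simps)
  also have "\<dots> \<le> T * (C * (p - 1) * v powr (p/2 - 1) + C * ((2 - p) * \<epsilon> * v powr (p/2 - 2)))"
    using T mC p \<epsilon> by (intro mult_left_mono add_left_mono mult_right_mono) auto
  also have "\<dots> = C * (v powr (p/2 - 2) * (v * T + (p - 2) * (a\<^sup>2 * T)))"
    unfolding vp by (simp add: v_def algebra_simps)
  finally show ?thesis
    by (simp add: w_def v_def C_def m_def \<kappa>_def)
qed

section \<open>Regularized powers of harmonic maps\<close>

lemma pd_pd_DERIV:
  assumes "harmonic_on G u" "b \<in> Basis" "x \<in> G"
  shows "((\<lambda>t. u (x + t *\<^sub>R b)) has_real_derivative pd b u x) (at 0)"
    and "((\<lambda>t. pd b u (x + t *\<^sub>R b)) has_real_derivative pd b (pd b u) x) (at 0)"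
  using assms unfolding harmonic_on_def C2_on_def by (auto intro: C1_on_DERIV)

text \<open>Both functions to be compared are instances: the full basis as index set gives
  \<epsilon> + |f|^2, a single basis vector gives \<epsilon> + f_1^2. Positivity of \<epsilon> keeps
  the real powers differentiable at zeros of the maps.\<close>

locale harmonic_tuple =
  fixes I :: "'i set" and v :: "'i \<Rightarrow> 'a::euclidean_space \<Rightarrow> real" and G :: "'a set"
    and \<epsilon> p :: real
  assumes finite_I: "finite I" and harmonic: "\<And>i. i \<in> I \<Longrightarrow> harmonic_on G (v i)" and \<epsilon>_pos: "\<epsilon> > 0"
begin

definition W :: "'a \<Rightarrow> real" where
  "W x = \<epsilon> + (\<Sum>i\<in>I. (v i x)\<^sup>2)"

text \<open>\<open>D b\<close> and \<open>D2 b\<close> are the first and second derivatives of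
  \<open>W x powr (p/2)\<close> in direction \<open>b\<close>, in closed form so that their
  continuity can be read off.\<close>

definition D :: "'a \<Rightarrow> 'a \<Rightarrow> real" where
  "D b x = p * (W x powr (p/2 - 1) * (\<Sum>i\<in>I. v i x * pd b (v i) x))"

definition D2 :: "'a \<Rightarrow> 'a \<Rightarrow> real" where
  "D2 b x = p * (W x powr (p/2 - 1) * (\<Sum>i\<in>I. (pd b (v i) x)\<^sup>2 + v i x * pd b (pd b (v i)) x)
     + (p - 2) * W x powr (p/2 - 2) * (\<Sum>i\<in>I. v i x * pd b (v i) x)\<^sup>2)"

lemma W_pos: "W x > 0"
  unfolding W_def using \<epsilon>_pos by (intro add_pos_nonneg sum_nonneg) auto

lemma W_nz: "W x \<noteq> 0"
  using W_pos[of x] by simp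

lemma DERIV_W:
  assumes "b \<in> Basis" "x \<in> G"
  shows "((\<lambda>t. W (x + t *\<^sub>R b)) has_real_derivative 2 * (\<Sum>i\<in>I. v i x * pd b (v i) x)) (at 0)"
proof -
  have "((\<lambda>t. \<epsilon> + (\<Sum>i\<in>I. (v i (x + t *\<^sub>R b))\<^sup>2)) has_real_derivative
      0 + (\<Sum>i\<in>I. of_nat 2 * (pd b (v i) x * v i (x + 0 *\<^sub>R b) ^ (2 - Suc 0)))) (at 0)"
    by (intro DERIV_add DERIV_const DERIV_sum DERIV_power pd_pd_DERIV(1)[OF harmonic assms])
  then show ?thesis
    unfolding W_def by (simp add: sum_distrib_left mult_ac)
qed

lemma DERIV_W_powr:
  assumes "b \<in> Basis" "x \<in> G"
  shows "((\<lambda>t. W (x + t *\<^sub>R b) powr q) has_real_derivative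
      2 * q * W x powr (q - 1) * (\<Sum>i\<in>I. v i x * pd b (v i) x)) (at 0)"
  using DERIV_powr[OF DERIV_W[OF assms] _ DERIV_const[of q], of] W_pos[of x] W_nz[of x]
  by (simp add: powr_diff field_simps)

lemma DERIV_W_powr_half:
  assumes "b \<in> Basis" "x \<in> G"
  shows "((\<lambda>t. W (x + t *\<^sub>R b) powr (p/2)) has_real_derivative D b x) (at 0)"
  using DERIV_W_powr[OF assms, of "p/2"] by (simp add: D_def mult_ac)

lemma DERIV_D:
  assumes "b \<in> Basis" "x \<in> G"
  shows "((\<lambda>t. D b (x + t *\<^sub>R b)) has_real_derivative D2 b x) (at 0)"
proof -
  let ?s = "\<lambda>x. \<Sum>i\<in>I. v i x * pd b (v i) x"
  have "((\<lambda>t. ?s (x + t *\<^sub>R b)) has_real_derivative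
     (\<Sum>i\<in>I. pd b (v i) x * pd b (v i) (x + 0 *\<^sub>R b) + pd b (pd b (v i)) x * v i (x + 0 *\<^sub>R b))) (at 0)"
    by (intro DERIV_sum DERIV_mult pd_pd_DERIV[OF harmonic assms])
  then have "((\<lambda>t. ?s (x + t *\<^sub>R b)) has_real_derivative
     (\<Sum>i\<in>I. (pd b (v i) x)\<^sup>2 + v i x * pd b (pd b (v i)) x)) (at 0)"
    by (simp add: power2_eq_square mult_ac)
  from DERIV_cmult[OF DERIV_mult[OF DERIV_W_powr[OF assms, of "p/2 - 1"] this], of p]
  show ?thesis
    unfolding D_def D2_def by (rule DERIV_cong) (simp add: power2_eq_square algebra_simps)
qed

lemma continuous_on_components:
  assumes "i \<in> I"
  shows "continuous_on G (v i)" "b \<in> Basis \<Longrightarrow> continuous_on G (pd b (v i))"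
    "b \<in> Basis \<Longrightarrow> continuous_on G (pd b (pd b (v i)))"
  using harmonic[OF assms] unfolding harmonic_on_def C2_on_def C1_on_def by auto

lemma continuous_on_W: "continuous_on G W"
  unfolding W_def by (intro continuous_intros continuous_on_components)

lemma continuous_on_W_powr: "continuous_on G (\<lambda>x. W x powr q)"
  using W_nz by (intro continuous_on_powr continuous_on_W continuous_on_const) auto

lemma continuous_on_D: "b \<in> Basis \<Longrightarrow> continuous_on G (D b)"
  unfolding D_def by (intro continuous_intros continuous_on_W_powr continuous_on_components)

lemma continuous_on_D2: "b \<in> Basis \<Longrightarrow> continuous_on G (D2 b)"
  unfolding D2_def by (intro continuous_intros continuous_on_W_powr continuous_on_components)

text \<open>Harmonicity cancels the terms with second derivatives of the components; the power p/2 -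
  2 is then factored out.\<close>

lemma laplacian:
  assumes "x \<in> G"
  shows "(\<Sum>b\<in>Basis. D2 b x) = p * (W x powr (p/2 - 2) *
     (W x * (\<Sum>i\<in>I. \<Sum>b\<in>Basis. (pd b (v i) x)\<^sup>2) + (p - 2) * (\<Sum>b\<in>Basis. (\<Sum>i\<in>I. v i x * pd b (v i) x)\<^sup>2)))"
proof -
  have "(\<Sum>b\<in>Basis. pd b (pd b (v i)) x) = 0" if "i \<in> I" for i
    using harmonic[OF that] assms by (simp add: harmonic_on_def)
  then have 0: "(\<Sum>b\<in>Basis. \<Sum>i\<in>I. v i x * pd b (pd b (v i)) x) = 0"
    by (subst sum.swap) (simp add: sum_distrib_left[symmetric])
  have w: "W x powr (p/2 - 1) = W x powr (p/2 - 2) * W x"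
    using powr_add[of "W x" "p/2 - 2" 1] W_pos[of x] by simp
  have "(\<Sum>b\<in>Basis. \<Sum>i\<in>I. (pd b (v i) x)\<^sup>2) = (\<Sum>i\<in>I. \<Sum>b\<in>Basis. (pd b (v i) x)\<^sup>2)"
    by (rule sum.swap)
  moreover have "(\<Sum>b\<in>Basis. D2 b x) = p * (W x powr (p/2 - 1) *
      ((\<Sum>b\<in>Basis. \<Sum>i\<in>I. (pd b (v i) x)\<^sup>2) + (\<Sum>b\<in>Basis. \<Sum>i\<in>I. v i x * pd b (pd b (v i)) x))
      + (p - 2) * W x powr (p/2 - 2) * (\<Sum>b\<in>Basis. (\<Sum>i\<in>I. v i x * pd b (v i) x)\<^sup>2))"
    by (simp only: D2_def sum.distrib sum_distrib_left[symmetric])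
  ultimately show ?thesis
    unfolding 0 w by (simp only: distrib_left add_0_right mult_ac)
qed

end

section \<open>Removing the regularization\<close>

lemma tendsto_regularized_mean:
  fixes h :: "'a::euclidean_space \<Rightarrow> 'b::euclidean_space"
  assumes h: "continuous_on (ball 0 1) h" and r: "0 < r" "r < 1" and p: "p > 0"
  shows "(\<lambda>k. LINT x:ball 0 1|lborel. (1 / real (Suc k) + (norm (h (r *\<^sub>R (x /\<^sub>R norm x))))\<^sup>2) powr (p/2))
    \<longlonglongrightarrow> (LINT x:ball 0 1|lborel. norm (h (r *\<^sub>R (x /\<^sub>R norm x))) powr p)"
proof -
  define \<Gamma> where "\<Gamma> x = h (r *\<^sub>R (x /\<^sub>R norm x))" for x
  have [measurable]: "\<Gamma> \<in> borel_measurable borel"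
    unfolding \<Gamma>_def using h r by (intro borel_measurable_radial_projection) auto
  obtain M where M: "\<And>x. norm (\<Gamma> x) \<le> M"
    unfolding \<Gamma>_def using bounded_radial_projection[OF h, of r] r by auto
  have pw: "(norm y)\<^sup>2 powr (p/2) = norm y powr p" for y :: 'b
    by (cases "y = 0") (simp_all add: powr_powr flip: powr_numeral)
  have lim0: "(\<lambda>k. 1 / real (Suc k)) \<longlonglongrightarrow> 0"
    using LIMSEQ_inverse_real_of_nat by (simp add: inverse_eq_divide)
  show ?thesis
    unfolding \<Gamma>_def[symmetric] set_lebesgue_integral_def
  \<comment> \<open>The regularizing parameter 1 / (k + 1) is at most 1, which makes this constant
    on the ball a dominating function.\<close>
  proof (rule integral_dominated_convergence[where w="\<lambda>x. indicator (ball 0 1) x *\<^sub>R (1 + M\<^sup>2) powr (p/2)"])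
    show "AE x in lborel. (\<lambda>k. indicator (ball 0 1) x *\<^sub>R (1 / real (Suc k) + (norm (\<Gamma> x))\<^sup>2) powr (p/2))
        \<longlonglongrightarrow> indicator (ball 0 1) x *\<^sub>R norm (\<Gamma> x) powr p"
    proof (intro AE_I2 tendsto_scaleR tendsto_const)
      fix x
      have "(\<lambda>k. (1 / real (Suc k) + (norm (\<Gamma> x))\<^sup>2) powr (p/2)) \<longlonglongrightarrow> (0 + (norm (\<Gamma> x))\<^sup>2) powr (p/2)"
        using p by (intro tendsto_powr' tendsto_add lim0 tendsto_const) (auto intro!: always_eventually)
      then show "(\<lambda>k. (1 / real (Suc k) + (norm (\<Gamma> x))\<^sup>2) powr (p/2)) \<longlonglongrightarrow> norm (\<Gamma> x) powr p"
        by (simp add: pw)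
    qed
    show "AE x in lborel. norm (indicator (ball 0 1) x *\<^sub>R (1 / real (Suc k) + (norm (\<Gamma> x))\<^sup>2) powr (p/2))
        \<le> indicator (ball 0 1) x *\<^sub>R (1 + M\<^sup>2) powr (p/2)" for k
    proof (intro AE_I2)
      fix x
      have "(1 / real (Suc k) + (norm (\<Gamma> x))\<^sup>2) powr (p/2) \<le> (1 + M\<^sup>2) powr (p/2)"
        using p M[of x] by (intro powr_mono2 add_mono power_mono) (auto simp: add_nonneg_nonneg)
      then show "norm (indicator (ball 0 1) x *\<^sub>R (1 / real (Suc k) + (norm (\<Gamma> x))\<^sup>2) powr (p/2))
        \<le> indicator (ball 0 1) x *\<^sub>R (1 + M\<^sup>2) powr (p/2)"
        by (simp add: indicator_def)
    qed
    show "integrable lborel (\<lambda>x. indicator (ball (0::'a) 1) x *\<^sub>R (1 + M\<^sup>2) powr (p/2))"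
      using emeasure_lborel_ball_finite[of "0::'a" 1] by (intro integrable_scaleR_left) simp
  qed (measurable; simp)+
qed

text \<open>The submean inequality for C (\<epsilon> + f_1^2)^(p/2) - (\<epsilon> + |f|^2)^(p/2) is
  taken at \<epsilon> = 1 / (k + 1), and k tends to infinity with \<open>r\<close> fixed.\<close>

lemma power_mean_estimate:
  fixes f :: "'a::euclidean_space \<Rightarrow> 'a"
  assumes qr: "quasiregular K (ball 0 1) f" and harm: "harmonic_map_on (ball 0 1) f"
    and p: "1 < p" "p \<le> 2" and e: "e \<in> Basis" and r: "0 < r" "r < 1"
  defines "C \<equiv> (1 + (real DIM('a) - 1) * K\<^sup>2) * (1 + (p - 2) / (real DIM('a) * K\<^sup>2)) / (p - 1)"
    and "B \<equiv> measure lborel (ball (0::'a) 1)"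
  shows "(LINT x:ball 0 1|lborel. norm (f (r *\<^sub>R (x /\<^sub>R norm x))) powr p) - norm (f 0) powr p * B
    \<le> C * ((LINT x:ball 0 1|lborel. norm (f (r *\<^sub>R (x /\<^sub>R norm x)) \<bullet> e) powr p) - norm (f 0 \<bullet> e) powr p * B)"
proof -
  let ?v = "\<lambda>i x. f x \<bullet> i"
  have h: "harmonic_on (ball 0 1) (?v i)" if "i \<in> Basis" for i
    using harm that by (simp add: harmonic_map_on_def)
  have C1: "C1_on (ball 0 1) (?v i)" if "i \<in> Basis" for i
    using h[OF that] by (simp add: harmonic_on_def C2_on_def)
  have K: "K \<ge> 1" using qr by (simp add: quasiregular_def)
  have fc: "continuous_on (ball 0 1) f" using qr by (simp add: quasiregular_def)
  have fec: "continuous_on (ball 0 1) (\<lambda>x. f x \<bullet> e)" by (intro continuous_intros fc)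
  have nsq: "(norm y)\<^sup>2 = (\<Sum>i\<in>Basis. (y \<bullet> i)\<^sup>2)" for y :: 'a
    unfolding power2_norm_eq_inner by (subst euclidean_inner) (simp add: power2_eq_square)
  let ?F = "\<lambda>\<epsilon> x. (\<epsilon> + (norm (f x))\<^sup>2) powr (p/2)"
  \<comment> \<open>The norm of a real number is written out so that the scalar and the vector case
    are instances of the same limit lemma.\<close>
  let ?U = "\<lambda>\<epsilon> x. (\<epsilon> + (norm (f x \<bullet> e))\<^sup>2) powr (p/2)"
  let ?\<pi> = "\<lambda>x::'a. r *\<^sub>R (x /\<^sub>R norm x)"
  have int: "set_integrable lborel (ball 0 1) (\<lambda>x. w (?\<pi> x))" if w: "continuous_on (ball 0 1) w" for w :: "'a \<Rightarrow> real"
  proof -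
    have "(\<lambda>x. w (?\<pi> x)) \<in> borel_measurable borel"
      using w r by (intro borel_measurable_radial_projection) auto
    moreover obtain M where "\<And>x. norm (w (?\<pi> x)) \<le> M"
      using bounded_radial_projection[OF w, of r] r by auto
    ultimately show ?thesis
      unfolding set_integrable_def using emeasure_lborel_ball_finite
      by (intro integrableI_bounded_set_indicator[where B=M]) auto
  qed
  have reg: "(LINT x:ball 0 1|lborel. ?F \<epsilon> (?\<pi> x)) - ?F \<epsilon> 0 * B
      \<le> C * ((LINT x:ball 0 1|lborel. ?U \<epsilon> (?\<pi> x)) - ?U \<epsilon> 0 * B)" if \<epsilon>: "\<epsilon> > 0" for \<epsilon>
  proof -
    interpret F: harmonic_tuple Basis ?v "ball 0 1" \<epsilon> p
      using h \<epsilon> by unfold_locales auto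
    interpret U: harmonic_tuple "{e}" ?v "ball 0 1" \<epsilon> p
      using h e \<epsilon> by unfold_locales auto
    have FW: "?F \<epsilon> x = F.W x powr (p/2)" and UW: "?U \<epsilon> x = U.W x powr (p/2)" for x
      by (simp_all add: F.W_def U.W_def nsq)
    let ?g = "\<lambda>x. C * U.W x powr (p/2) - F.W x powr (p/2)"
    have cF: "continuous_on (ball 0 1) (\<lambda>x. F.W x powr (p/2))"
      and cU: "continuous_on (ball 0 1) (\<lambda>x. C * U.W x powr (p/2))"
      by (intro continuous_intros F.continuous_on_W_powr U.continuous_on_W_powr)+
    have "?g 0 * B \<le> (LINT x:ball 0 1|lborel. ?g (?\<pi> x))"
      unfolding B_def
    proof (rule submean_sphere[where D="\<lambda>b x. C * U.D b x - F.D b x" and D'="\<lambda>b x. C * U.D2 b x - F.D2 b x"])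
      show "continuous_on (ball 0 1) ?g"
        by (intro continuous_on_diff cF cU)
      fix b :: 'a assume b: "b \<in> Basis"
      show "continuous_on (ball 0 1) (\<lambda>x. C * U.D b x - F.D b x)"
        by (intro continuous_intros U.continuous_on_D F.continuous_on_D b)
      show "continuous_on (ball 0 1) (\<lambda>x. C * U.D2 b x - F.D2 b x)"
        by (intro continuous_intros U.continuous_on_D2 F.continuous_on_D2 b)
      fix x :: 'a assume x: "x \<in> ball 0 1"
      show "((\<lambda>t. C * U.W (x + t *\<^sub>R b) powr (p/2) - F.W (x + t *\<^sub>R b) powr (p/2))
          has_real_derivative C * U.D b x - F.D b x) (at 0)"
        by (intro DERIV_diff DERIV_cmult U.DERIV_W_powr_half F.DERIV_W_powr_half b x)
      show "((\<lambda>t. C * U.D b (x + t *\<^sub>R b) - F.D b (x + t *\<^sub>R b))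
          has_real_derivative C * U.D2 b x - F.D2 b x) (at 0)"
        by (intro DERIV_diff DERIV_cmult U.DERIV_D F.DERIV_D b x)
    next
      fix x :: 'a assume x: "x \<in> ball 0 1"
      have sq_le: "(f x \<bullet> e)\<^sup>2 \<le> (norm (f x))\<^sup>2"
        using e Basis_le_norm[of e "f x"] by (metis abs_le_square_iff abs_norm_cancel)
      have "(\<epsilon> + (norm (f x))\<^sup>2) powr (p/2 - 2) * ((\<epsilon> + (norm (f x))\<^sup>2) * (\<Sum>i\<in>Basis. \<Sum>j\<in>Basis. (pd j (?v i) x)\<^sup>2)
            + (p - 2) * (\<Sum>j\<in>Basis. (\<Sum>i\<in>Basis. (f x \<bullet> i) * pd j (?v i) x)\<^sup>2))
          \<le> C * ((\<epsilon> + (f x \<bullet> e)\<^sup>2) powr (p/2 - 2) * ((\<epsilon> + (f x \<bullet> e)\<^sup>2) * (\<Sum>j\<in>Basis. (pd j (?v e) x)\<^sup>2)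
            + (p - 2) * ((f x \<bullet> e)\<^sup>2 * (\<Sum>j\<in>Basis. (pd j (?v e) x)\<^sup>2))))"
        unfolding C_def
        using DIM_positive[where 'a='a] gradient_bounds[OF qr C1 x e]
        by (intro regularized_laplacian_le p K \<epsilon> sq_le sum_nonneg) auto
      then have "p * ((\<epsilon> + (norm (f x))\<^sup>2) powr (p/2 - 2) * ((\<epsilon> + (norm (f x))\<^sup>2) * (\<Sum>i\<in>Basis. \<Sum>j\<in>Basis. (pd j (?v i) x)\<^sup>2)
            + (p - 2) * (\<Sum>j\<in>Basis. (\<Sum>i\<in>Basis. (f x \<bullet> i) * pd j (?v i) x)\<^sup>2)))
          \<le> p * (C * ((\<epsilon> + (f x \<bullet> e)\<^sup>2) powr (p/2 - 2) * ((\<epsilon> + (f x \<bullet> e)\<^sup>2) * (\<Sum>j\<in>Basis. (pd j (?v e) x)\<^sup>2)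
            + (p - 2) * ((f x \<bullet> e)\<^sup>2 * (\<Sum>j\<in>Basis. (pd j (?v e) x)\<^sup>2)))))"
        using p by (intro mult_left_mono) auto
      \<comment> \<open>For the single component the mixed sum in the Laplacian collapses to f_1^2
        times its squared gradient, the form in which the algebraic inequality is stated.\<close>
      then have "(\<Sum>b\<in>Basis. F.D2 b x) \<le> C * (\<Sum>b\<in>Basis. U.D2 b x)"
        unfolding F.laplacian[OF x] U.laplacian[OF x]
        by (simp add: F.W_def U.W_def nsq power_mult_distrib sum_distrib_left mult_ac)
      then show "0 \<le> (\<Sum>b\<in>Basis. C * U.D2 b x - F.D2 b x)"
        by (simp add: sum_subtractf sum_distrib_left)
    qed (use r in auto)
    also have "\<dots> = C * (LINT x:ball 0 1|lborel. U.W (?\<pi> x) powr (p/2)) - (LINT x:ball 0 1|lborel. F.W (?\<pi> x) powr (p/2))"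
      using int[OF cU] int[OF cF] by (subst set_integral_diff) auto
    finally show ?thesis
      unfolding FW UW by (simp add: algebra_simps)
  qed
  have inv: "1 / real (Suc k) > 0" for k by simp
  have lim0: "(\<lambda>k. 1 / real (Suc k)) \<longlonglongrightarrow> 0"
    using LIMSEQ_inverse_real_of_nat by (simp add: inverse_eq_divide)
  have pw: "((norm y)\<^sup>2) powr (p/2) = norm y powr p" for y :: "'c::real_normed_vector"
    by (cases "y = 0") (simp_all add: powr_powr flip: powr_numeral)
  have at0: "(\<lambda>k. (1 / real (Suc k) + (norm y)\<^sup>2) powr (p/2)) \<longlonglongrightarrow> norm y powr p" for y :: "'c::real_normed_vector"
  proof -
    have "(\<lambda>k. (1 / real (Suc k) + (norm y)\<^sup>2) powr (p/2)) \<longlonglongrightarrow> (0 + (norm y)\<^sup>2) powr (p/2)"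
      using p by (intro tendsto_powr' tendsto_add lim0 tendsto_const) (auto intro!: always_eventually)
    then show ?thesis by (simp add: pw)
  qed
  show ?thesis
  proof (rule LIMSEQ_le)
    show "(\<lambda>k. (LINT x:ball 0 1|lborel. ?F (1 / real (Suc k)) (?\<pi> x)) - ?F (1 / real (Suc k)) 0 * B)
      \<longlonglongrightarrow> (LINT x:ball 0 1|lborel. norm (f (?\<pi> x)) powr p) - norm (f 0) powr p * B"
      using p by (intro tendsto_intros tendsto_regularized_mean fc r at0) auto
    show "(\<lambda>k. C * ((LINT x:ball 0 1|lborel. ?U (1 / real (Suc k)) (?\<pi> x)) - ?U (1 / real (Suc k)) 0 * B))
      \<longlonglongrightarrow> C * ((LINT x:ball 0 1|lborel. norm (f (?\<pi> x) \<bullet> e) powr p) - norm (f 0 \<bullet> e) powr p * B)"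
      using p by (intro tendsto_intros tendsto_regularized_mean fec r at0) auto
  qed (use reg inv in blast)
qed

section \<open>Hardy norms\<close>

lemma Mp_eq:
  fixes f :: "'a::euclidean_space \<Rightarrow> 'b::euclidean_space"
  assumes f: "continuous_on (ball 0 1) f" and r: "0 < r" "r < 1"
  shows "Mp p f r = ((LINT x:ball 0 1|lborel. norm (f (r *\<^sub>R (x /\<^sub>R norm x))) powr p)
           / measure lborel (ball (0::'a) 1)) powr (1 / p)"
proof -
  have [measurable]: "(\<lambda>x. f (r *\<^sub>R (x /\<^sub>R norm x))) \<in> borel_measurable borel"
    using f r by (intro borel_measurable_radial_projection) auto
  have "(LINT x:ball 0 1|lebesgue. norm (f (r *\<^sub>R (x /\<^sub>R norm x))) powr p)
      = (LINT x:ball 0 1|lborel. norm (f (r *\<^sub>R (x /\<^sub>R norm x))) powr p)"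
    unfolding set_lebesgue_integral_def
    by (intro integral_completion borel_measurable_scaleR borel_measurable_indicator) measurable
  then show ?thesis by (simp add: Mp_def)
qed

lemma Mp_powr:
  fixes f :: "'a::euclidean_space \<Rightarrow> 'b::euclidean_space"
  assumes "continuous_on (ball 0 1) f" "0 < r" "r < 1" "p > 0"
  shows "Mp p f r powr p * measure lborel (ball (0::'a) 1)
      = (LINT x:ball 0 1|lborel. norm (f (r *\<^sub>R (x /\<^sub>R norm x))) powr p)"
proof -
  have "0 \<le> (LINT x:ball 0 1|lborel. norm (f (r *\<^sub>R (x /\<^sub>R norm x))) powr p)"
    unfolding set_lebesgue_integral_def by (intro Bochner_Integration.integral_nonneg) simp
  moreover have "measure lborel (ball (0::'a) 1) > 0"
    using content_ball_pos[of 1 "0::'a"] by simp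
  ultimately show ?thesis
    using assms by (simp add: Mp_eq powr_powr)
qed

text \<open>Undoing the p-th root needs a nonnegative base. As n K^2 \<ge> 1, the factor 1 + (p - 2)
  / (n K^2) is at least p - 1 > 0, which also makes the constant at least 1; the planar case relies
  on the latter.\<close>

lemma cnKp_powr:
  assumes "1 < p" "p \<le> 2" "K \<ge> 1" "n \<ge> 1"
  shows "cnKp n K p powr p = (1 + (real n - 1) * K\<^sup>2) * (1 + (p - 2) / (real n * K\<^sup>2)) / (p - 1)"
    and "n \<ge> 2 \<Longrightarrow> 1 \<le> cnKp n K p powr p"
proof -
  have K2: "K\<^sup>2 \<ge> 1" using assms by simp
  have nK: "real n * K\<^sup>2 \<ge> 1" using mult_mono[of 1 "real n" 1 "K\<^sup>2"] assms K2 by simp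
  have "(2 - p) / (real n * K\<^sup>2) \<le> 2 - p"
    using nK assms by (simp add: divide_le_eq mult_le_cancel_left1)
  then have a: "1 + (p - 2) / (real n * K\<^sup>2) \<ge> p - 1"
    by (simp add: diff_divide_distrib)
  have b: "1 + (real n - 1) * K\<^sup>2 \<ge> 1" using assms by simp
  have nonneg: "0 \<le> (1 + (real n - 1) * K\<^sup>2) * (1 + (p - 2) / (real n * K\<^sup>2)) / (p - 1)"
    using a b assms by (intro divide_nonneg_nonneg mult_nonneg_nonneg) auto
  show eq: "cnKp n K p powr p = (1 + (real n - 1) * K\<^sup>2) * (1 + (p - 2) / (real n * K\<^sup>2)) / (p - 1)"
  proof -
    have "(q powr (1 / p)) powr p = q" if "0 \<le> q" for q
      using that assms(1) by (simp add: powr_powr)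
    then show ?thesis unfolding cnKp_def using nonneg by blast
  qed
  have "1 * (p - 1) \<le> (1 + (real n - 1) * K\<^sup>2) * (1 + (p - 2) / (real n * K\<^sup>2))"
    using a b assms by (intro mult_mono) auto
  then show "1 \<le> cnKp n K p powr p"
    unfolding eq using assms by (simp add: le_divide_eq)
qed

text \<open>Dividing the estimate at radius \<open>r\<close> by the volume of the ball and replacing
  the mean of the component by its Hardy norm gives a bound for the mean of f that is independent of
  \<open>r\<close>. Any basis vector may take the place of the first coordinate.\<close>

lemma quasiregular_harmonic_hardy:
  fixes f :: "'a::euclidean_space \<Rightarrow> 'a"
  assumes qr: "quasiregular K (ball 0 1) f" and harm: "harmonic_map_on (ball 0 1) f"
    and p: "1 < p" "p \<le> 2" and e: "e \<in> Basis" and hardy: "hardy p (\<lambda>x. f x \<bullet> e)"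
  shows "hardy p f"
    and "hnorm p f powr p \<le> norm (f 0) powr p
       + cnKp DIM('a) K p powr p * (hnorm p (\<lambda>x. f x \<bullet> e) powr p - \<bar>f 0 \<bullet> e\<bar> powr p)"
    and "0 \<le> hnorm p f" and "0 \<le> hnorm p (\<lambda>x. f x \<bullet> e)"
proof -
  let ?C = "cnKp DIM('a) K p powr p" and ?fe = "\<lambda>x. f x \<bullet> e"
  let ?B = "measure lborel (ball (0::'a) 1)"
  have K: "K \<ge> 1" using qr by (simp add: quasiregular_def)
  have fc: "continuous_on (ball 0 1) f" using qr by (simp add: quasiregular_def)
  have fec: "continuous_on (ball 0 1) ?fe" by (intro continuous_intros fc)
  have p0: "p > 0" using p by simp
  have B: "?B > 0" using content_ball_pos[of 1 "0::'a"] by simp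
  have n: "DIM('a) \<ge> 1" by (simp add: Suc_leI)
  define H where "H = norm (f 0) powr p + ?C * (hnorm p ?fe powr p - \<bar>f 0 \<bullet> e\<bar> powr p)"
  have le_hnorm: "Mp p ?fe r \<le> hnorm p ?fe" if "0 < r" "r < 1" for r
    unfolding hnorm_def using hardy that by (intro cSUP_upper) (auto simp: hardy_def)
  have Mp_nonneg: "0 \<le> Mp p g r" for g :: "'a \<Rightarrow> 'c::real_normed_vector" and r
    by (simp add: Mp_def)
  have bound: "Mp p f r powr p \<le> H" if r: "0 < r" "r < 1" for r
  proof -
    have "(Mp p f r powr p - norm (f 0) powr p) * ?B
        \<le> (?C * (Mp p ?fe r powr p - \<bar>f 0 \<bullet> e\<bar> powr p)) * ?B"
      using power_mean_estimate[OF qr harm p e r, folded cnKp_powr(1)[OF p K n],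
          folded Mp_powr[OF fc r p0] Mp_powr[OF fec r p0]]
      by (simp add: algebra_simps)
    then have "Mp p f r powr p - norm (f 0) powr p \<le> ?C * (Mp p ?fe r powr p - \<bar>f 0 \<bullet> e\<bar> powr p)"
      using B by simp
    also have "\<dots> \<le> ?C * (hnorm p ?fe powr p - \<bar>f 0 \<bullet> e\<bar> powr p)"
      using le_hnorm[OF r] Mp_nonneg p by (intro mult_left_mono diff_right_mono powr_mono2) auto
    finally show ?thesis by (simp add: H_def)
  qed
  \<comment> \<open>The radius 1/2 is an arbitrary choice; nonnegativity of \<open>H\<close> lets
    its p-th root be inverted.\<close>
  have H: "0 \<le> H" using order_trans[OF powr_ge_zero bound[of "1/2"]] by simp
  have Mp_le: "Mp p f r \<le> H powr (1 / p)" if "r \<in> {0<..<1}" for r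
  proof -
    have "Mp p f r = (Mp p f r powr p) powr (1 / p)"
      using p Mp_nonneg[of f r] by (simp add: powr_powr)
    also have "\<dots> \<le> H powr (1 / p)"
      using that p by (intro powr_mono2 bound) auto
    finally show ?thesis .
  qed
  show hf: "hardy p f"
    unfolding hardy_def using Mp_le by (rule bdd_aboveI2)
  \<comment> \<open>A real supremum dominates a nonnegative mean once the means are bounded above,
    which is what \<open>hardy\<close> supplies.\<close>
  have nonneg: "0 \<le> hnorm p g" if "hardy p g" for g :: "'a \<Rightarrow> 'c::real_normed_vector"
    unfolding hnorm_def using that Mp_nonneg[of g "1/2"]
    by (intro cSUP_upper2[where x="1/2"]) (auto simp: hardy_def)
  show "0 \<le> hnorm p f" "0 \<le> hnorm p ?fe"
    using nonneg hf hardy by auto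
  have "hnorm p f \<le> H powr (1 / p)"
    unfolding hnorm_def using Mp_le by (intro cSUP_least) auto
  then have "hnorm p f powr p \<le> (H powr (1 / p)) powr p"
    using \<open>0 \<le> hnorm p f\<close> p by (intro powr_mono2) auto
  also have "\<dots> = H" using p H by (simp add: powr_powr)
  finally show "hnorm p f powr p \<le> norm (f 0) powr p + ?C * (hnorm p ?fe powr p - \<bar>f 0 \<bullet> e\<bar> powr p)"
    by (simp add: H_def)
qed

section \<open>Specialization to the disk and to the unit ball of R^n\<close>

theorem theorem2p1:
  fixes p K :: real
  assumes "1 < p" and "p \<le> 2" and "K \<ge> 1" and "CARD('n::finite) \<ge> 2"
  shows "(\<forall>f :: complex \<Rightarrow> complex.
            quasiregular K (ball 0 1) f \<and> harmonic_map_on (ball 0 1) f \<and> Im (f 0) = 0 \<and>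
            hardy p (\<lambda>z. Re (f z))
            \<longrightarrow> hardy p f \<and> hnorm p f \<le> cnKp 2 K p * hnorm p (\<lambda>z. Re (f z)))
       \<and> (\<forall>(f :: real^'n \<Rightarrow> real^'n) (i :: 'n).
            quasiregular K (ball 0 1) f \<and> harmonic_map_on (ball 0 1) f \<and>
            hardy p (\<lambda>x. f x $ i)
            \<longrightarrow> hardy p f \<and>
                hnorm p f powr p \<le> norm (f 0) powr p
                  + cnKp CARD('n) K p powr p * (hnorm p (\<lambda>x. f x $ i) powr p - \<bar>f 0 $ i\<bar> powr p))"
proof (intro conjI allI impI; elim conjE)
  fix f :: "complex \<Rightarrow> complex"
  assume f: "quasiregular K (ball 0 1) f" "harmonic_map_on (ball 0 1) f" "Im (f 0) = 0" "hardy p (\<lambda>z. Re (f z))"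
  have Re: "f z \<bullet> 1 = Re (f z)" for z
    by (simp add: inner_complex_def)
  note est = quasiregular_harmonic_hardy[OF f(1,2) assms(1,2), of 1, unfolded Re, OF _ f(4)]
  show "hardy p f" by (rule est(1)) (simp add: Basis_complex_def)
  have b: "(1::complex) \<in> Basis" by (simp add: Basis_complex_def)
  let ?N = "hnorm p (\<lambda>z. Re (f z))"
  \<comment> \<open>The normalization Im f(0) = 0 makes both values at the origin equal, so they
    combine into one term with coefficient 1 - C.\<close>
  have "norm (f 0) = \<bar>Re (f 0)\<bar>"
    using f(3) by (simp add: cmod_def)
  then have "hnorm p f powr p \<le> \<bar>Re (f 0)\<bar> powr p + cnKp 2 K p powr p * (?N powr p - \<bar>Re (f 0)\<bar> powr p)"
    using est(2)[OF b] by simp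
  also have "\<dots> = cnKp 2 K p powr p * ?N powr p - (cnKp 2 K p powr p - 1) * \<bar>Re (f 0)\<bar> powr p"
    by (simp add: algebra_simps)
  \<comment> \<open>The term at the origin is dropped because the constant is at least 1.\<close>
  also have "\<dots> \<le> cnKp 2 K p powr p * ?N powr p"
    using cnKp_powr(2)[OF assms(1-3), of 2] by simp
  also have "\<dots> = (cnKp 2 K p * ?N) powr p"
    using est(4)[OF b] by (simp add: powr_mult cnKp_def)
  finally have le: "hnorm p f powr p \<le> (cnKp 2 K p * ?N) powr p" .
  have "0 \<le> cnKp 2 K p * ?N"
    using est(4)[OF b] by (simp add: cnKp_def)
  \<comment> \<open>The p-th power is strictly increasing on nonnegative reals, so the inequality
    between powers gives the one between the norms.\<close>
  then show "hnorm p f \<le> cnKp 2 K p * ?N"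
    using le powr_less_mono2[of p "cnKp 2 K p * ?N" "hnorm p f"] assms(1) by (meson not_le order_less_trans zero_less_one)
next
  fix f :: "real^'n \<Rightarrow> real^'n" and i :: 'n
  assume f: "quasiregular K (ball 0 1) f" "harmonic_map_on (ball 0 1) f" "hardy p (\<lambda>x. f x $ i)"
  have ax: "f x \<bullet> axis i 1 = f x $ i" for x
    by (simp add: inner_axis)
  have b: "axis i 1 \<in> (Basis :: (real^'n) set)" by simp
  note est = quasiregular_harmonic_hardy[OF f(1,2) assms(1,2) b, unfolded ax, OF f(3)]
  show "hardy p f" by (rule est(1))
  show "hnorm p f powr p \<le> norm (f 0) powr p
      + cnKp CARD('n) K p powr p * (hnorm p (\<lambda>x. f x $ i) powr p - \<bar>f 0 $ i\<bar> powr p)"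
    using est(2) by simp
qed

end
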